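(* Let $1\le p<\infty$, $d>2p$, $\Omega=[0,1]^d$. Let $\mu$ belong to a class of probability measures on $\Omega$ for which there exists an estimator $\tilde\mu_n$ (a probability measure on $\Omega$ constructed from an i.i.d. sample of size $n$ from $\mu$), from which one can efficiently sample, and such that $$\mathbb E\,W_p(\tilde\mu_n,\mu)\lesssim n^{-\gamma^*/d}.$$ Then for any $\gamma\in[1,\gamma^*]$, the estimator resample distribution $\bar\mu_{n,M}$ with $M=\lceil n^\gamma\rceil$ satisfies $$\mathbb E\,W_p(\mu,\bar\mu_{n,M})\lesssim n^{-\gamma/d}.$$ The constants implied by $\lesssim$ do not depend on $n$.
   Context: $W_p$ denotes the $p$-Wasserstein distance: $W_p^p(\mu,\nu)=\inf_\pi\int\|x-y\|^p\,d\pi(x,y)$ over couplings $\pi$ of $\mu$ and $\nu$, with $\|\cdot\|$ the Euclidean norm. Estimator resample distribution: given a probability measure $\tilde\mu_n$ (computed from the data) and, conditionally on the data, an i.i.d. sample $Z_1,\dots,Z_M$ from $\tilde\mu_n$, $\bar\mu_{n,M}=\frac1M\sum_{i=1}^M\delta_{Z_i}$ is the empirical distribution of the $Z_i$. "Efficiently sample" only means that such draws $Z_i$ are available to the statistician. $\mathbb E$ is over both the data and the $Z_i$. *)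

theory Defs
  imports "HOL-Probability.Probability"
begin

definition ennreal_powr :: "ennreal \<Rightarrow> real \<Rightarrow> ennreal" where
  "ennreal_powr c a = (if c = \<top> then \<top> else ennreal (enn2real c powr a))"

definition couplings :: "'a measure \<Rightarrow> 'b measure \<Rightarrow> ('a \<times> 'b) measure set" where
  "couplings \<mu> \<nu> = {\<pi> \<in> space (prob_algebra (\<mu> \<Otimes>\<^sub>M \<nu>)). distr \<pi> \<mu> fst = \<mu> \<and> distr \<pi> \<nu> snd = \<nu>}"

(* Values in [0, top]; on measures supported in a common bounded set the value is finite. *)
definition wasserstein ::
    "real \<Rightarrow> 'a::real_normed_vector measure \<Rightarrow> 'a measure \<Rightarrow> ennreal" where
  "wasserstein p \<mu> \<nu> =
     ennreal_powr (INF \<pi>\<in>couplings \<mu> \<nu>. \<integral>\<^sup>+(x, y). ennreal (norm (x - y) powr p) \<partial>\<pi>) (1 / p)"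

(* The Borel space [0,1]^d, with d = CARD('d).  A probability measure on the cube is an element
   of space (prob_algebra cube): its underlying space is the cube itself, not all of real^'d. *)
definition cube :: "(real ^ 'd) measure" where
  "cube = restrict_space borel {x. \<forall>i. 0 \<le> x $ i \<and> x $ i \<le> 1}"

(* The law of an i.i.d. sample of size n from \<mu>; a sample is a function on {..<n}. *)
definition iid_sample :: "nat \<Rightarrow> 'a measure \<Rightarrow> (nat \<Rightarrow> 'a) measure" where
  "iid_sample n \<mu> = PiM {..<n} (\<lambda>_. \<mu>)"

(* (1/m) (\<delta>_{z 0} + ... + \<delta>_{z (m-1)}) as a measure on N; see emeasure_empirical. *)
definition empirical :: "'a measure \<Rightarrow> nat \<Rightarrow> (nat \<Rightarrow> 'a) \<Rightarrow> 'a measure" where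
  "empirical N m z = distr (uniform_count_measure {..<m}) N z"

lemma emeasure_empirical:
  assumes "m > 0" "\<And>i. i < m \<Longrightarrow> z i \<in> space N" "A \<in> sets N"
  shows "emeasure (empirical N m z) A = (\<Sum>i<m. emeasure (return N (z i)) A) / of_nat m"
proof -
  have "z \<in> measurable (uniform_count_measure {..<m}) N"
    using assms(2)
    by (auto simp: measurable_def sets_uniform_count_measure space_uniform_count_measure)
  then have "emeasure (empirical N m z) A
      = emeasure (uniform_count_measure {..<m}) (z -` A \<inter> {..<m})"
    unfolding empirical_def using assms(3)
    by (simp add: emeasure_distr space_uniform_count_measure)
  also have "\<dots> = ennreal (real (card (z -` A \<inter> {..<m})) / real m)"
    by (subst emeasure_uniform_count_measure) auto
  also have "\<dots> = of_nat (card (z -` A \<inter> {..<m})) / of_nat m"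
    using assms(1) by (simp add: divide_ennreal ennreal_of_nat_eq_real_of_nat)
  also have "of_nat (card (z -` A \<inter> {..<m})) = (\<Sum>i<m. emeasure (return N (z i)) A)"
  proof -
    have "(\<Sum>i<m. emeasure (return N (z i)) A) = (\<Sum>i<m. indicator (z -` A) i)"
      using assms(3) by (intro sum.cong) (auto simp: indicator_def)
    also have "\<dots> = of_nat (card ({..<m} \<inter> z -` A))"
      unfolding indicator_def by (subst sum_of_bool_eq) (simp_all add: vimage_def)
    finally show ?thesis by (simp add: Int_commute)
  qed
  finally show ?thesis .
qed

(* An estimator assigns to n and to the data x 0, ..., x (n-1) a probability measure on the cube,
   measurably in the data. *)
definition estimator :: "(nat \<Rightarrow> (nat \<Rightarrow> real ^ 'd) \<Rightarrow> (real ^ 'd) measure) \<Rightarrow> bool" where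
  "estimator est \<longleftrightarrow> (\<forall>n. est n \<in> measurable (PiM {..<n} (\<lambda>_. cube)) (prob_algebra cube))"

(* E W_p(est_n, \<mu>) for data drawn i.i.d. from \<mu>. *)
definition estimator_risk ::
    "real \<Rightarrow> (nat \<Rightarrow> (nat \<Rightarrow> real ^ 'd) \<Rightarrow> (real ^ 'd) measure) \<Rightarrow> nat \<Rightarrow> (real ^ 'd) measure \<Rightarrow> ennreal"
  where
  "estimator_risk p est n \<mu> = (\<integral>\<^sup>+x. wasserstein p (est n x) \<mu> \<partial>iid_sample n \<mu>)"

(* E W_p(\<mu>, empirical measure of z 0, ..., z (m-1)), where the data x are i.i.d. from \<mu> and,
   conditionally on x, the z i are i.i.d. from est n x. *)
definition resample_risk ::
    "real \<Rightarrow> (nat \<Rightarrow> (nat \<Rightarrow> real ^ 'd) \<Rightarrow> (real ^ 'd) measure) \<Rightarrow> nat \<Rightarrow> nat \<Rightarrow> (real ^ 'd) measure \<Rightarrow> ennreal"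
  where
  "resample_risk p est n m \<mu> =
     (\<integral>\<^sup>+x. (\<integral>\<^sup>+z. wasserstein p \<mu> (empirical cube m z) \<partial>iid_sample m (est n x)) \<partial>iid_sample n \<mu>)"

end

theory Submission
  imports Defs
begin

text \<open>
  Let \<open>\<nu>\<close> be a probability measure on the cube and \<open>\<nu>\<^sub>m\<close> the empirical measure of \<open>m\<close> draws from it.
  Matching masses greedily along the dyadic partitions, from the finest level \<open>K\<close> upwards, transports
  \<open>\<nu>\<close> to \<open>\<nu>\<^sub>m\<close> at cost at most a constant times
  \<open>2 powr (- K p) + (\<Sum>k<K. 2 powr (- k p) * (\<Sum>Q. \<bar>\<nu> Q - \<nu>\<^sub>m Q\<bar>))\<close>, where \<open>Q\<close> runs over the cells of level
  \<open>k + 1\<close>. The variance of the cell counts bounds the expected inner sum by \<open>sqrt (2 ^ ((k + 1) d) / m)\<close>;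
  for \<open>d > 2 p\<close> the last level dominates, and \<open>2 ^ K\<close> of order \<open>m powr (1 / d)\<close> gives the rate
  \<open>m powr (- p / d)\<close>.

  The greedy plan has a density with respect to the product measure, so composing it with any
  coupling of \<open>\<nu>\<close> and \<open>\<mu>\<close> needs no disintegration. With the crude bound
  \<open>(a + b) powr p \<le> 2 powr p * (a powr p + b powr p)\<close> this replaces the triangle inequality for \<open>W\<^sub>p\<close>, up to a
  factor. Applying this to \<open>\<nu>\<close> the estimator yields the claim, since \<open>m \<ge> n powr \<gamma>\<close>.
\<close>

section \<open>Transport along nested partitions\<close>

text \<open>The marginals are only bounded by \<open>a\<close> and \<open>b\<close>, since a plan is
  grown one level at a time and is complete only after the coarsest level.\<close>

definition subplan :: "'i set \<Rightarrow> ('i \<Rightarrow> real) \<Rightarrow> ('i \<Rightarrow> real) \<Rightarrow> ('i \<Rightarrow> 'i \<Rightarrow> real) \<Rightarrow> bool" where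
  "subplan I a b w \<longleftrightarrow> (\<forall>i\<in>I. \<forall>j\<in>I. 0 \<le> w i j) \<and>
     (\<forall>i\<in>I. (\<Sum>j\<in>I. w i j) \<le> a i) \<and> (\<forall>j\<in>I. (\<Sum>i\<in>I. w i j) \<le> b j)"

text \<open>Pairwise form of a statement about cells: if one row of a cell of \<open>g\<close> is
  not exhausted, its pairs with all points of the cell force every column there to be full. So each
  cell has used up all of its \<open>a\<close>-mass or all of its \<open>b\<close>-mass.\<close>

definition saturated ::
    "'i set \<Rightarrow> ('i \<Rightarrow> real) \<Rightarrow> ('i \<Rightarrow> real) \<Rightarrow> ('i \<Rightarrow> 'c) \<Rightarrow> ('i \<Rightarrow> 'i \<Rightarrow> real) \<Rightarrow> bool" where
  "saturated I a b g w \<longleftrightarrow>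
     (\<forall>i\<in>I. \<forall>j\<in>I. g i = g j \<longrightarrow> (\<Sum>k\<in>I. w i k) = a i \<or> (\<Sum>k\<in>I. w k j) = b j)"

text \<open>Inside every cell of \<open>g\<close>, the leftover masses are matched proportionally until one of them
  is exhausted.\<close>

lemma subplan_saturate:
  fixes a b :: "'i \<Rightarrow> real" and g :: "'i \<Rightarrow> 'c"
  assumes fin: "finite I" and w: "subplan I a b w"
  obtains w' where "subplan I a b w'" "saturated I a b g w'"
    "\<And>i j. i \<in> I \<Longrightarrow> j \<in> I \<Longrightarrow> w i j \<le> w' i j"
    "\<And>i j. g i \<noteq> g j \<Longrightarrow> w' i j = w i j"
proof -
  define r where "r i = a i - (\<Sum>j\<in>I. w i j)" for i
  define s where "s j = b j - (\<Sum>i\<in>I. w i j)" for j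
  define cell where "cell i = {j\<in>I. g j = g i}" for i
  define A where "A i = sum r (cell i)" for i
  define B where "B i = sum s (cell i)" for i
  \<comment> \<open>\<open>A i\<close> and \<open>B i\<close> are the leftover masses of the cell of
    \<open>i\<close>, and \<open>v\<close> moves their minimum inside that cell. Dividing by the
    maximum keeps both marginals below the leftovers; a cell with nothing left yields 0 through
    division by zero.\<close>
  define v where "v i j = (if g i = g j then r i * s j / max (A i) (B i) else 0)" for i j
  have r0: "0 \<le> r i" if "i \<in> I" for i using w that by (simp add: subplan_def r_def)
  have s0: "0 \<le> s i" if "i \<in> I" for i using w that by (simp add: subplan_def s_def)
  have A0: "0 \<le> A i" for i unfolding A_def cell_def by (auto intro!: sum_nonneg r0)
  have B0: "0 \<le> B i" for i unfolding B_def cell_def by (auto intro!: sum_nonneg s0)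
  have fc: "finite (cell i)" for i unfolding cell_def using fin by simp
  have cong: "A i = A j" "B i = B j" if "g i = g j" for i j
    using that by (simp_all add: A_def B_def cell_def)
  have rA: "r i \<le> A i" if "i \<in> I" for i
    unfolding A_def by (rule member_le_sum) (use that fc r0 in \<open>auto simp: cell_def\<close>)
  have sB: "s i \<le> B i" if "i \<in> I" for i
    unfolding B_def by (rule member_le_sum) (use that fc s0 in \<open>auto simp: cell_def\<close>)
  have row: "(\<Sum>j\<in>I. v i j) = r i * (B i / max (A i) (B i))" for i
  proof -
    have "(\<Sum>j\<in>I. v i j) = (\<Sum>j\<in>cell i. r i * s j / max (A i) (B i))"
      unfolding v_def cell_def using fin by (intro sum.mono_neutral_cong_right) auto
    then show ?thesis by (simp add: B_def sum_distrib_left sum_divide_distrib)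
  qed
  have col: "(\<Sum>i\<in>I. v i j) = s j * (A j / max (A j) (B j))" for j
  proof -
    have "(\<Sum>i\<in>I. v i j) = (\<Sum>i\<in>cell j. s j * r i / max (A j) (B j))"
    proof (intro sum.mono_neutral_cong_right ballI)
      fix i assume "i \<in> cell j"
      then have "g i = g j" by (simp add: cell_def)
      then show "v i j = s j * r i / max (A j) (B j)"
        using cong[of i j] by (simp add: v_def)
    qed (use fin in \<open>auto simp: v_def cell_def\<close>)
    then show ?thesis by (simp add: A_def sum_distrib_left sum_divide_distrib)
  qed
  have v0: "0 \<le> v i j" if "i \<in> I" "j \<in> I" for i j
    unfolding v_def using r0[OF that(1)] s0[OF that(2)] A0[of i] B0[of i]
    by (auto intro!: divide_nonneg_nonneg)
  have f1: "B i / max (A i) (B i) \<le> 1" "A i / max (A i) (B i) \<le> 1" for i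
    using A0[of i] B0[of i] by (auto simp: divide_le_eq_1 max_def)
  have row_le: "(\<Sum>j\<in>I. v i j) \<le> r i" if "i \<in> I" for i
    unfolding row using mult_left_mono[OF f1(1) r0[OF that]] by simp
  have col_le: "(\<Sum>i\<in>I. v i j) \<le> s j" if "j \<in> I" for j
    unfolding col using mult_left_mono[OF f1(2) s0[OF that]] by simp
  show ?thesis
  proof (rule that[of "\<lambda>i j. w i j + v i j"])
    show "subplan I a b (\<lambda>i j. w i j + v i j)"
      unfolding subplan_def
    proof (intro conjI ballI)
      show "0 \<le> w i j + v i j" if "i \<in> I" "j \<in> I" for i j
        using w v0[OF that] that by (simp add: subplan_def)
      show "(\<Sum>j\<in>I. w i j + v i j) \<le> a i" if "i \<in> I" for i
        using row_le[OF that] by (simp add: sum.distrib r_def)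
      show "(\<Sum>i\<in>I. w i j + v i j) \<le> b j" if "j \<in> I" for j
        using col_le[OF that] by (simp add: sum.distrib s_def)
    qed
    show "saturated I a b g (\<lambda>i j. w i j + v i j)"
      unfolding saturated_def
    proof (intro ballI impI)
      fix i j assume ij: "i \<in> I" "j \<in> I" "g i = g j"
      \<comment> \<open>The side with the smaller leftover in the cell is exhausted. If both
        leftovers vanish, the ratio is 0 / 0, but then \<open>r i\<close> is 0 as well.\<close>
      have "(\<Sum>k\<in>I. v i k) = r i \<or> (\<Sum>k\<in>I. v k j) = s j"
      proof (cases "A i \<le> B i")
        case True
        show ?thesis
        proof (cases "B i = 0")
          case True
          then have "r i = 0" using \<open>A i \<le> B i\<close> r0[OF ij(1)] rA[OF ij(1)] by linarith
          then show ?thesis by (simp add: row)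
        next
          case False
          with True show ?thesis by (simp add: row max_def)
        qed
      next
        case False
        then have "A i \<noteq> 0" using B0[of i] by linarith
        with False show ?thesis using cong[OF ij(3)] by (simp add: col max_def)
      qed
      then show "(\<Sum>k\<in>I. w i k + v i k) = a i \<or> (\<Sum>k\<in>I. w k j + v k j) = b j"
        by (auto simp: sum.distrib r_def s_def)
    qed
    show "w i j \<le> w i j + v i j" if "i \<in> I" "j \<in> I" for i j
      using v0[OF that] by simp
    show "w i j + v i j = w i j" if "g i \<noteq> g j" for i j
      using that by (simp add: v_def)
  qed
qed

text \<open>No mass leaves or enters a cell, so the mass sent there equals the mass received. In a
  saturated cell either all of the \<open>a\<close>-mass has been sent and nothing is left, or all
  of the \<open>b\<close>-mass has been received and the leftover is the difference of the two
  masses.\<close>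

lemma saturated_leftover:
  fixes a b :: "'i \<Rightarrow> real" and g :: "'i \<Rightarrow> 'c"
  assumes fin: "finite I" and w: "subplan I a b w" and sat: "saturated I a b g w"
    and supp: "\<And>i j. i \<in> I \<Longrightarrow> j \<in> I \<Longrightarrow> g i \<noteq> g j \<Longrightarrow> w i j = 0"
  shows "(\<Sum>i\<in>I. a i - (\<Sum>j\<in>I. w i j))
    \<le> (\<Sum>Q\<in>g ` I. \<bar>(\<Sum>i | i \<in> I \<and> g i = Q. a i) - (\<Sum>i | i \<in> I \<and> g i = Q. b i)\<bar>)"
proof -
  have "(\<Sum>i\<in>I. a i - (\<Sum>j\<in>I. w i j))
      = (\<Sum>Q\<in>g ` I. \<Sum>i | i \<in> I \<and> g i = Q. a i - (\<Sum>j\<in>I. w i j))"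
    using fin by (rule sum.image_gen)
  also have "\<dots> \<le> (\<Sum>Q\<in>g ` I. \<bar>(\<Sum>i | i \<in> I \<and> g i = Q. a i) - (\<Sum>i | i \<in> I \<and> g i = Q. b i)\<bar>)"
  proof (rule sum_mono)
    fix Q
    let ?C = "{i \<in> I. g i = Q}"
    have fC: "finite ?C" using fin by simp
    have rows: "(\<Sum>j\<in>I. w i j) = (\<Sum>j\<in>?C. w i j)" if "i \<in> ?C" for i
      using that fin supp by (intro sum.mono_neutral_right) (auto, metis)
    have cols: "(\<Sum>i\<in>I. w i j) = (\<Sum>i\<in>?C. w i j)" if "j \<in> ?C" for j
      using that fin supp by (intro sum.mono_neutral_right) auto
    have eq: "(\<Sum>i\<in>?C. \<Sum>j\<in>I. w i j) = (\<Sum>j\<in>?C. \<Sum>i\<in>I. w i j)"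
    proof -
      have "(\<Sum>i\<in>?C. \<Sum>j\<in>I. w i j) = (\<Sum>i\<in>?C. \<Sum>j\<in>?C. w i j)"
        by (rule sum.cong[OF refl rows])
      also have "\<dots> = (\<Sum>j\<in>?C. \<Sum>i\<in>?C. w i j)" by (rule sum.swap)
      also have "\<dots> = (\<Sum>j\<in>?C. \<Sum>i\<in>I. w i j)"
        by (rule sum.cong[OF refl cols[symmetric]])
      finally show ?thesis .
    qed
    show "(\<Sum>i\<in>?C. a i - (\<Sum>j\<in>I. w i j)) \<le> \<bar>sum a ?C - sum b ?C\<bar>"
    proof (cases "\<forall>i\<in>?C. (\<Sum>j\<in>I. w i j) = a i")
      case True
      then show ?thesis by simp
    next
      case False
      then obtain i where "i \<in> ?C" "(\<Sum>j\<in>I. w i j) \<noteq> a i" by blast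
      then have "\<forall>j\<in>?C. (\<Sum>i\<in>I. w i j) = b j"
        using sat unfolding saturated_def by fastforce
      then have "(\<Sum>i\<in>?C. \<Sum>j\<in>I. w i j) = sum b ?C" unfolding eq by simp
      then show ?thesis by (simp add: sum_subtractf)
    qed
  qed
  finally show ?thesis .
qed

text \<open>Levels are treated from the finest to the coarsest. Matching at level \<open>k\<close>
  costs at most \<open>D k\<close> per unit of the mass left over after level \<open>Suc k\<close>,
  and the discrepancies of the cells of level \<open>Suc k\<close> bound that mass. At level
  \<open>K\<close> everything is still unmatched, whence the term
  \<open>D K * sum a I\<close>.\<close>

lemma nested_partition_transport:
  fixes a b :: "'i \<Rightarrow> real" and q :: "nat \<Rightarrow> 'i \<Rightarrow> 'c" and D :: "nat \<Rightarrow> real"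
    and c :: "'i \<Rightarrow> 'i \<Rightarrow> real"
  assumes fin: "finite I" and a0: "\<And>i. i \<in> I \<Longrightarrow> 0 \<le> a i" and b0: "\<And>i. i \<in> I \<Longrightarrow> 0 \<le> b i"
    and ab: "sum a I = sum b I"
    and root: "\<And>i j. i \<in> I \<Longrightarrow> j \<in> I \<Longrightarrow> q 0 i = q 0 j"
    and nested: "\<And>k i j. i \<in> I \<Longrightarrow> j \<in> I \<Longrightarrow> k < K \<Longrightarrow> q (Suc k) i = q (Suc k) j \<Longrightarrow> q k i = q k j"
    and D0: "\<And>k. 0 \<le> D k"
    and c: "\<And>k i j. i \<in> I \<Longrightarrow> j \<in> I \<Longrightarrow> k \<le> K \<Longrightarrow> q k i = q k j \<Longrightarrow> c i j \<le> D k"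
  obtains w where "\<And>i j. i \<in> I \<Longrightarrow> j \<in> I \<Longrightarrow> 0 \<le> w i j"
    "\<And>i. i \<in> I \<Longrightarrow> (\<Sum>j\<in>I. w i j) = a i" "\<And>j. j \<in> I \<Longrightarrow> (\<Sum>i\<in>I. w i j) = b j"
    "(\<Sum>i\<in>I. \<Sum>j\<in>I. w i j * c i j) \<le> D K * sum a I + (\<Sum>k<K. D k * (\<Sum>Q\<in>q (Suc k) ` I.
       \<bar>(\<Sum>i | i \<in> I \<and> q (Suc k) i = Q. a i) - (\<Sum>i | i \<in> I \<and> q (Suc k) i = Q. b i)\<bar>))"
proof -
  define E where "E k = (\<Sum>Q\<in>q k ` I.
       \<bar>(\<Sum>i | i \<in> I \<and> q k i = Q. a i) - (\<Sum>i | i \<in> I \<and> q k i = Q. b i)\<bar>)" for k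
  define cost where "cost w = (\<Sum>i\<in>I. \<Sum>j\<in>I. w i j * c i j)" for w
  \<comment> \<open>The state after levels \<open>K\<close> down to \<open>k\<close>: the plan stays
    inside the cells of level \<open>k\<close>, saturates them, and has been paid for level by
    level.\<close>
  define P where "P k w \<longleftrightarrow> subplan I a b w \<and> saturated I a b (q k) w \<and>
      (\<forall>i\<in>I. \<forall>j\<in>I. q k i \<noteq> q k j \<longrightarrow> w i j = 0) \<and>
      cost w \<le> D K * sum a I + (\<Sum>l=k..<K. D l * E (Suc l))" for k w
  \<comment> \<open>\<open>subplan_saturate\<close> changes only entries inside a cell of level
    \<open>k\<close>, where \<open>c\<close> is at most \<open>D k\<close>, and the total amount
    added cannot exceed what the rows still lack.\<close>
  have extend: "\<exists>w'. subplan I a b w' \<and> saturated I a b (q k) w' \<and>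
      (\<forall>i\<in>I. \<forall>j\<in>I. q k i \<noteq> q k j \<longrightarrow> w' i j = 0) \<and>
      cost w' \<le> cost w + D k * (\<Sum>i\<in>I. a i - (\<Sum>j\<in>I. w i j))"
    if w: "subplan I a b w" and k: "k \<le> K"
      and supp: "\<forall>i\<in>I. \<forall>j\<in>I. q k i \<noteq> q k j \<longrightarrow> w i j = 0" for w k
  proof -
    obtain w' where w': "subplan I a b w'" "saturated I a b (q k) w'"
      and le: "\<And>i j. i \<in> I \<Longrightarrow> j \<in> I \<Longrightarrow> w i j \<le> w' i j"
      and eq: "\<And>i j. q k i \<noteq> q k j \<Longrightarrow> w' i j = w i j"
      using subplan_saturate[OF fin w, where g = "q k"] by blast
    have "cost w' - cost w = (\<Sum>i\<in>I. \<Sum>j\<in>I. (w' i j - w i j) * c i j)"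
      by (simp add: cost_def sum_subtractf left_diff_distrib)
    also have "\<dots> \<le> (\<Sum>i\<in>I. \<Sum>j\<in>I. (w' i j - w i j) * D k)"
    proof (intro sum_mono)
      fix i j assume "i \<in> I" "j \<in> I"
      then show "(w' i j - w i j) * c i j \<le> (w' i j - w i j) * D k"
        using le[of i j] eq[of i j] c[of i j k] k
        by (cases "q k i = q k j") (auto intro!: mult_left_mono)
    qed
    also have "\<dots> = D k * (\<Sum>i\<in>I. (\<Sum>j\<in>I. w' i j) - (\<Sum>j\<in>I. w i j))"
      by (simp add: sum_distrib_left sum_subtractf algebra_simps)
    also have "\<dots> \<le> D k * (\<Sum>i\<in>I. a i - (\<Sum>j\<in>I. w i j))"
      using w'(1) D0 by (intro mult_left_mono sum_mono) (auto simp: subplan_def)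
    finally show ?thesis using w' eq supp by (intro exI[of _ w']) auto
  qed
  have "\<exists>w. P 0 w"
  proof (rule inc_induct[of 0 K "\<lambda>k. \<exists>w. P k w"])
    have "subplan I a b (\<lambda>i j. 0)" using a0 b0 by (simp add: subplan_def)
    from extend[OF this order_refl] show "\<exists>w. P K w"
      by (auto simp: P_def cost_def)
  next
    fix k assume k: "k < K" and "\<exists>w. P (Suc k) w"
    then obtain w where w: "subplan I a b w" and sat: "saturated I a b (q (Suc k)) w"
      and supp: "\<forall>i\<in>I. \<forall>j\<in>I. q (Suc k) i \<noteq> q (Suc k) j \<longrightarrow> w i j = 0"
      and cw: "cost w \<le> D K * sum a I + (\<Sum>l=Suc k..<K. D l * E (Suc l))"
      by (auto simp: P_def)
    have supp': "\<forall>i\<in>I. \<forall>j\<in>I. q k i \<noteq> q k j \<longrightarrow> w i j = 0"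
      using supp nested[OF _ _ k] by blast
    obtain w' where w': "subplan I a b w'" "saturated I a b (q k) w'"
      "\<forall>i\<in>I. \<forall>j\<in>I. q k i \<noteq> q k j \<longrightarrow> w' i j = 0"
      and cw': "cost w' \<le> cost w + D k * (\<Sum>i\<in>I. a i - (\<Sum>j\<in>I. w i j))"
      using extend[OF w less_imp_le[OF k] supp'] by blast
    have "(\<Sum>i\<in>I. a i - (\<Sum>j\<in>I. w i j)) \<le> E (Suc k)"
      unfolding E_def using saturated_leftover[OF fin w sat] supp by blast
    then have "D k * (\<Sum>i\<in>I. a i - (\<Sum>j\<in>I. w i j)) \<le> D k * E (Suc k)"
      by (intro mult_left_mono D0)
    moreover have "(\<Sum>l=k..<K. D l * E (Suc l)) = D k * E (Suc k) + (\<Sum>l=Suc k..<K. D l * E (Suc l))"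
      using k by (rule sum.atLeast_Suc_lessThan)
    ultimately have "P k w'" using w' cw cw' unfolding P_def by linarith
    then show "\<exists>w. P k w" by blast
  qed simp
  then obtain w where w: "subplan I a b w" and sat: "saturated I a b (q 0) w"
    and cw: "cost w \<le> D K * sum a I + (\<Sum>l=0..<K. D l * E (Suc l))"
    by (auto simp: P_def)
  have ra: "(\<Sum>j\<in>I. w i j) \<le> a i" if "i \<in> I" for i using w that by (simp add: subplan_def)
  have rb: "(\<Sum>i\<in>I. w i j) \<le> b j" if "j \<in> I" for j using w that by (simp add: subplan_def)
  have swap: "(\<Sum>i\<in>I. \<Sum>j\<in>I. w i j) = (\<Sum>j\<in>I. \<Sum>i\<in>I. w i j)" by (rule sum.swap)
  \<comment> \<open>The root is a single cell, so all rows or all columns are full. As the totals of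
    \<open>a\<close> and \<open>b\<close> agree, the mass of the plan equals both, and then no
    single row or column can fall short.\<close>
  have "(\<forall>i\<in>I. (\<Sum>j\<in>I. w i j) = a i) \<or> (\<forall>j\<in>I. (\<Sum>i\<in>I. w i j) = b j)"
    using sat root unfolding saturated_def by blast
  then have tot: "(\<Sum>i\<in>I. \<Sum>j\<in>I. w i j) = sum a I" "(\<Sum>j\<in>I. \<Sum>i\<in>I. w i j) = sum b I"
    using swap ab by auto
  show ?thesis
  proof (rule that[of w])
    show "(\<Sum>j\<in>I. w i j) = a i" if "i \<in> I" for i
      using sum_mono_inv[OF tot(1) ra that fin] by simp
    show "(\<Sum>i\<in>I. w i j) = b j" if "j \<in> I" for j
      using sum_mono_inv[OF tot(2) rb that fin] by simp
    show "0 \<le> w i j" if "i \<in> I" "j \<in> I" for i j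
      using w that by (simp add: subplan_def)
  qed (use cw in \<open>simp add: cost_def E_def atLeast0LessThan\<close>)
qed

section \<open>Plans with a density\<close>

lemma nn_integral_finite_range:
  fixes g :: "'c \<Rightarrow> ennreal"
  assumes "finite I" and f: "\<And>i. i \<in> I \<Longrightarrow> f -` {i} \<inter> space M \<in> sets M"
    and sub: "f ` space M \<subseteq> I"
  shows "(\<integral>\<^sup>+x. g (f x) \<partial>M) = (\<Sum>i\<in>I. g i * emeasure M (f -` {i} \<inter> space M))"
proof -
  have "(\<integral>\<^sup>+x. g (f x) \<partial>M) = (\<integral>\<^sup>+x. (\<Sum>i\<in>I. g i * indicator (f -` {i} \<inter> space M) x) \<partial>M)"
  proof (rule nn_integral_cong)
    fix x assume x: "x \<in> space M"
    have "(\<Sum>i\<in>I. g i * indicator (f -` {i} \<inter> space M) x) = (\<Sum>i\<in>I. if i = f x then g i else 0)"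
      using x by (intro sum.cong) (auto simp: indicator_def)
    also have "\<dots> = g (f x)" using \<open>finite I\<close> sub x by (auto simp: sum.delta)
    finally show "g (f x) = (\<Sum>i\<in>I. g i * indicator (f -` {i} \<inter> space M) x)" by simp
  qed
  also have "\<dots> = (\<Sum>i\<in>I. g i * emeasure M (f -` {i} \<inter> space M))"
    using f by (subst nn_integral_sum) (auto simp: nn_integral_cmult_indicator)
  finally show ?thesis .
qed

text \<open>The cells of level \<open>K\<close> reduce the problem to finitely many indices. The
  finite plan is spread over each pair of cells in proportion to the product measure, so its density
  is constant on such pairs. The marginals are right almost everywhere only, because cells without
  mass receive density 0.\<close>

lemma nested_partition_density:
  fixes \<nu> \<nu>' N :: "'a measure" and q :: "nat \<Rightarrow> 'a \<Rightarrow> 'c" and D :: "nat \<Rightarrow> real"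
    and c :: "'a \<Rightarrow> 'a \<Rightarrow> real"
  assumes \<nu>: "\<nu> \<in> space (prob_algebra N)" and \<nu>': "\<nu>' \<in> space (prob_algebra N)"
    and finL: "\<And>k. finite (L k)"
    and q: "\<And>k. q k \<in> N \<rightarrow>\<^sub>M count_space (L k)"
    and root: "\<And>x y. x \<in> space N \<Longrightarrow> y \<in> space N \<Longrightarrow> q 0 x = q 0 y"
    and nested: "\<And>k x y. x \<in> space N \<Longrightarrow> y \<in> space N \<Longrightarrow> q (Suc k) x = q (Suc k) y \<Longrightarrow> q k x = q k y"
    and D0: "\<And>k. 0 \<le> D k"
    and c: "\<And>k x y. x \<in> space N \<Longrightarrow> y \<in> space N \<Longrightarrow> q k x = q k y \<Longrightarrow> c x y \<le> D k"
  obtains w :: "'a \<Rightarrow> 'a \<Rightarrow> ennreal"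
  where "(\<lambda>(x, y). w x y) \<in> borel_measurable (N \<Otimes>\<^sub>M N)"
    "AE x in \<nu>. (\<integral>\<^sup>+y. w x y \<partial>\<nu>') = 1" "AE y in \<nu>'. (\<integral>\<^sup>+x. w x y \<partial>\<nu>) = 1"
    "(\<integral>\<^sup>+x. \<integral>\<^sup>+y. w x y * ennreal (c x y) \<partial>\<nu>' \<partial>\<nu>) \<le> ennreal (D K + (\<Sum>k<K. D k *
       (\<Sum>Q\<in>L (Suc k). \<bar>measure \<nu> (q (Suc k) -` {Q} \<inter> space N)
                         - measure \<nu>' (q (Suc k) -` {Q} \<inter> space N)\<bar>)))"
proof -
  interpret \<nu>: prob_space \<nu> using \<nu> by (simp add: space_prob_algebra)
  interpret \<nu>': prob_space \<nu>' using \<nu>' by (simp add: space_prob_algebra)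
  have sets: "sets \<nu> = sets N" "sets \<nu>' = sets N" using \<nu> \<nu>' by (simp_all add: space_prob_algebra)
  have sp: "space \<nu> = space N" "space \<nu>' = space N" using sets[THEN sets_eq_imp_space_eq] .
  have qL: "q k x \<in> L k" if "x \<in> space N" for k x using measurable_space[OF q that] by simp
  define cell where "cell k Q = q k -` {Q} \<inter> space N" for k Q
  have cell: "cell k Q \<in> sets N" for k Q
  proof (cases "Q \<in> L k")
    case True
    then show ?thesis unfolding cell_def by (intro measurable_sets[OF q]) auto
  next
    case False
    then have "cell k Q = {}" using qL by (auto simp: cell_def)
    then show ?thesis by simp
  qed
  define I where "I = q K ` space N"
  \<comment> \<open>A point of each finest cell, so that for \<open>k \<le> K\<close> the label of
    the level-\<open>k\<close> cell containing cell \<open>i\<close> can be read off as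
    \<open>q k (rep i)\<close>.\<close>
  define rep where "rep = inv_into (space N) (q K)"
  have finI: "finite I" using finL[of K] qL by (rule_tac finite_subset[of I "L K"]) (auto simp: I_def)
  have rep: "rep i \<in> space N" "q K (rep i) = i" if "i \<in> I" for i
    using that unfolding I_def rep_def by (simp_all add: inv_into_into f_inv_into_f)
  have anc: "q k x = q k y" if "k \<le> K" "x \<in> space N" "y \<in> space N" "q K x = q K y" for k x y
    using that(1)
  proof (induction rule: inc_induct)
    case base
    show ?case by (rule that(4))
  next
    case (step n)
    show ?case by (rule nested[OF that(2,3) step.IH])
  qed
  have anc_rep: "q k (rep (q K x)) = q k x" if "k \<le> K" "x \<in> space N" for k x
    using anc[OF that(1) _ that(2), of "rep (q K x)"] rep[of "q K x"] that by (auto simp: I_def)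
  define a where "a i = measure \<nu> (cell K i)" for i
  define b where "b i = measure \<nu>' (cell K i)" for i
  \<comment> \<open>The finite transport lemma takes a cost on indices: here the best bound among
    the levels up to \<open>K\<close> at which the two cells share an ancestor. Level 0 always
    qualifies, so the minimum is over a nonempty set.\<close>
  define cc where "cc i j = Min (D ` {k. k \<le> K \<and> q k (rep i) = q k (rep j)})" for i j
  \<comment> \<open>By nestedness a cell of level \<open>k\<close> is the disjoint union of the
    cells of level \<open>K\<close> whose representatives lie in it.\<close>
  have cellsum: "(\<Sum>i | i \<in> I \<and> q k (rep i) = Q. measure \<sigma> (cell K i)) = measure \<sigma> (cell k Q)"
    if "k \<le> K" "finite_measure \<sigma>" "sets \<sigma> = sets N" for k Q and \<sigma> :: "'a measure"
  proof -
    interpret finite_measure \<sigma> by fact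
    have eq: "cell k Q = (\<Union>i\<in>{i \<in> I. q k (rep i) = Q}. cell K i)"
      using anc_rep[OF that(1)] by (auto simp: cell_def I_def; metis)
    show ?thesis unfolding eq using finI cell
      by (subst finite_measure_finite_Union)
         (auto simp: that(3) cell_def disjoint_family_on_def image_subset_iff)
  qed
  have tot: "sum a I = 1" "sum b I = 1"
  proof -
    have x: "sum (\<lambda>i. measure \<sigma> (cell K i)) I = 1" if "prob_space \<sigma>" "sets \<sigma> = sets N" for \<sigma> :: "'a measure"
    proof -
      interpret prob_space \<sigma> by fact
      have "space \<sigma> = (\<Union>i\<in>I. cell K i)"
        using sets_eq_imp_space_eq[OF that(2)] by (auto simp: cell_def I_def)
      then have "1 = measure \<sigma> (\<Union>i\<in>I. cell K i)" using prob_space by simp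
      also have "\<dots> = sum (\<lambda>i. measure \<sigma> (cell K i)) I"
        using finI cell that(2)
        by (intro finite_measure_finite_Union) (auto simp: cell_def disjoint_family_on_def image_subset_iff)
      finally show ?thesis by simp
    qed
    show "sum a I = 1" "sum b I = 1"
      unfolding a_def b_def using x sets \<nu>.prob_space_axioms \<nu>'.prob_space_axioms by blast+
  qed
  have cc_le: "cc i j \<le> D k" if "k \<le> K" "q k (rep i) = q k (rep j)" for i j k
    unfolding cc_def using that by (intro Min_le) auto
  have c_cc: "c x y \<le> cc (q K x) (q K y)" if "x \<in> space N" "y \<in> space N" for x y
    unfolding cc_def
  proof (rule Min.boundedI)
    have "q 0 (rep (q K x)) = q 0 (rep (q K y))"
      using that by (intro root rep) (auto simp: I_def)
    then show "D ` {k. k \<le> K \<and> q k (rep (q K x)) = q k (rep (q K y))} \<noteq> {}" by auto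
  qed (use that c anc_rep in \<open>auto\<close>)
  obtain w where w0: "\<And>i j. i \<in> I \<Longrightarrow> j \<in> I \<Longrightarrow> 0 \<le> w i j"
    and row: "\<And>i. i \<in> I \<Longrightarrow> (\<Sum>j\<in>I. w i j) = a i" and col: "\<And>j. j \<in> I \<Longrightarrow> (\<Sum>i\<in>I. w i j) = b j"
    and cost: "(\<Sum>i\<in>I. \<Sum>j\<in>I. w i j * cc i j) \<le> D K * sum a I
      + (\<Sum>k<K. D k * (\<Sum>Q\<in>(\<lambda>i. q (Suc k) (rep i)) ` I.
       \<bar>(\<Sum>i | i \<in> I \<and> q (Suc k) (rep i) = Q. a i) - (\<Sum>i | i \<in> I \<and> q (Suc k) (rep i) = Q. b i)\<bar>))"
  proof (rule nested_partition_transport[OF finI, of a b "\<lambda>k i. q k (rep i)" K D cc])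
    show "0 \<le> a i" "0 \<le> b i" for i by (simp_all add: a_def b_def)
    show "sum a I = sum b I" by (simp add: tot)
    show "q 0 (rep i) = q 0 (rep j)" if "i \<in> I" "j \<in> I" for i j
      using that by (intro root rep)
    show "q k (rep i) = q k (rep j)"
      if "i \<in> I" "j \<in> I" "q (Suc k) (rep i) = q (Suc k) (rep j)" for i j k
      by (rule nested[OF rep(1)[OF that(1)] rep(1)[OF that(2)] that(3)])
    show "0 \<le> D k" for k by (rule D0)
    show "cc i j \<le> D k" if "k \<le> K" "q k (rep i) = q k (rep j)" for i j k
      using that by (rule cc_le)
  qed (use that in blast)
  have wa: "w i j = 0" if "i \<in> I" "j \<in> I" "a i = 0" for i j
    using row[OF that(1)] that w0 finI by (simp add: sum_nonneg_eq_0_iff)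
  have wb: "w i j = 0" if "i \<in> I" "j \<in> I" "b j = 0" for i j
    using col[OF that(2)] that w0 finI by (simp add: sum_nonneg_eq_0_iff)
  define W where "W i j = w i j / (a i * b j)" for i j
  have ab0: "0 \<le> a i" "0 \<le> b i" for i by (simp_all add: a_def b_def)
  have W0: "0 \<le> W i j" if "i \<in> I" "j \<in> I" for i j
    using w0[OF that] ab0 by (auto simp: W_def)
  \<comment> \<open>Division by zero loses nothing: an entry of \<open>w\<close> vanishes as soon as
    its row or its column has mass 0.\<close>
  have Wab: "W i j * a i * b j = w i j" if "i \<in> I" "j \<in> I" for i j
    using wa[OF that] wb[OF that] by (auto simp: W_def)
  have em: "emeasure \<nu> (cell K i) = ennreal (a i)" "emeasure \<nu>' (cell K i) = ennreal (b i)" for i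
    by (simp_all add: a_def b_def \<nu>.emeasure_eq_measure \<nu>'.emeasure_eq_measure)
  have int\<nu>: "(\<integral>\<^sup>+x. g (q K x) \<partial>\<nu>) = (\<Sum>i\<in>I. g i * ennreal (a i))" for g
    using cell em finI unfolding cell_def
    by (subst nn_integral_finite_range[of I]) (auto simp: sp sets I_def)
  have int\<nu>': "(\<integral>\<^sup>+x. g (q K x) \<partial>\<nu>') = (\<Sum>i\<in>I. g i * ennreal (b i))" for g
    using cell em finI unfolding cell_def
    by (subst nn_integral_finite_range[of I]) (auto simp: sp sets I_def)
  have AE\<nu>: "AE x in \<nu>. a (q K x) \<noteq> 0"
  proof -
    have "AE x in \<nu>. \<forall>i\<in>I. a i = 0 \<longrightarrow> x \<notin> cell K i"
      using finI cell by (intro AE_finite_allI) (auto intro!: AE_not_in simp: null_sets_def sets em)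
    then show ?thesis by (rule AE_mp) (auto intro!: AE_I2 simp: sp cell_def I_def)
  qed
  have AE\<nu>': "AE x in \<nu>'. b (q K x) \<noteq> 0"
  proof -
    have "AE x in \<nu>'. \<forall>i\<in>I. b i = 0 \<longrightarrow> x \<notin> cell K i"
      using finI cell by (intro AE_finite_allI) (auto intro!: AE_not_in simp: null_sets_def sets em)
    then show ?thesis by (rule AE_mp) (auto intro!: AE_I2 simp: sp cell_def I_def)
  qed
  show ?thesis
  proof (rule that[of "\<lambda>x y. ennreal (W (q K x) (q K y))"])
    have "(\<lambda>(x, y). (q K x, q K y)) \<in> N \<Otimes>\<^sub>M N \<rightarrow>\<^sub>M count_space (L K) \<Otimes>\<^sub>M count_space (L K)"
      using q by measurable
    then have "(\<lambda>(x, y). (q K x, q K y)) \<in> N \<Otimes>\<^sub>M N \<rightarrow>\<^sub>M count_space (L K \<times> L K)"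
      using finL by (simp add: pair_measure_count_space)
    from measurable_compose[OF this, of "\<lambda>(i, j). ennreal (W i j)" borel]
    show "(\<lambda>(x, y). ennreal (W (q K x) (q K y))) \<in> borel_measurable (N \<Otimes>\<^sub>M N)"
      by (simp add: case_prod_beta')
  next
    have "(\<integral>\<^sup>+y. ennreal (W (q K x) (q K y)) \<partial>\<nu>') = 1" if "x \<in> space \<nu>" "a (q K x) \<noteq> 0" for x
    proof -
      let ?i = "q K x"
      have i: "?i \<in> I" using that by (auto simp: I_def sp)
      have "(\<integral>\<^sup>+y. ennreal (W ?i (q K y)) \<partial>\<nu>') = (\<Sum>j\<in>I. ennreal (W ?i j) * ennreal (b j))"
        by (rule int\<nu>')
      also have "\<dots> = ennreal (\<Sum>j\<in>I. W ?i j * b j)"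
        using i W0 ab0 by (subst sum_ennreal[symmetric]) (auto simp: ennreal_mult)
      also have "(\<Sum>j\<in>I. W ?i j * b j) = (\<Sum>j\<in>I. w ?i j / a ?i)"
        using Wab[OF i] that by (intro sum.cong) (auto simp: field_simps)
      also have "\<dots> = 1" using row[OF i] that by (simp flip: sum_divide_distrib)
      finally show ?thesis by simp
    qed
    with AE\<nu> show "AE x in \<nu>. (\<integral>\<^sup>+y. ennreal (W (q K x) (q K y)) \<partial>\<nu>') = 1" by (auto elim!: AE_mp)
  next
    have "(\<integral>\<^sup>+x. ennreal (W (q K x) (q K y)) \<partial>\<nu>) = 1" if "y \<in> space \<nu>'" "b (q K y) \<noteq> 0" for y
    proof -
      let ?j = "q K y"
      have j: "?j \<in> I" using that by (auto simp: I_def sp)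
      have "(\<integral>\<^sup>+x. ennreal (W (q K x) ?j) \<partial>\<nu>) = (\<Sum>i\<in>I. ennreal (W i ?j) * ennreal (a i))"
        by (rule int\<nu>)
      also have "\<dots> = ennreal (\<Sum>i\<in>I. W i ?j * a i)"
        using j W0 ab0 by (subst sum_ennreal[symmetric]) (auto simp: ennreal_mult)
      also have "(\<Sum>i\<in>I. W i ?j * a i) = (\<Sum>i\<in>I. w i ?j / b ?j)"
        using Wab[OF _ j] that by (intro sum.cong) (auto simp: field_simps)
      also have "\<dots> = 1" using col[OF j] that by (simp flip: sum_divide_distrib)
      finally show ?thesis by simp
    qed
    with AE\<nu>' show "AE y in \<nu>'. (\<integral>\<^sup>+x. ennreal (W (q K x) (q K y)) \<partial>\<nu>) = 1" by (auto elim!: AE_mp)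
  next
    have cc0: "0 \<le> cc i j" if "i \<in> I" "j \<in> I" for i j
    proof -
      have "q 0 (rep i) = q 0 (rep j)" using that by (intro root rep)
      then show ?thesis unfolding cc_def using D0 by (intro Min.boundedI) auto
    qed
    have "(\<integral>\<^sup>+x. \<integral>\<^sup>+y. ennreal (W (q K x) (q K y)) * ennreal (c x y) \<partial>\<nu>' \<partial>\<nu>)
        \<le> (\<integral>\<^sup>+x. \<integral>\<^sup>+y. ennreal (W (q K x) (q K y)) * ennreal (cc (q K x) (q K y)) \<partial>\<nu>' \<partial>\<nu>)"
      using c_cc by (intro nn_integral_mono mult_left_mono ennreal_leI) (auto simp: sp)
    also have "\<dots> = (\<integral>\<^sup>+x. (\<Sum>j\<in>I. ennreal (W (q K x) j) * ennreal (cc (q K x) j) * ennreal (b j)) \<partial>\<nu>)"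
      by (subst int\<nu>') (rule refl)
    also have "\<dots> = (\<Sum>i\<in>I. (\<Sum>j\<in>I. ennreal (W i j) * ennreal (cc i j) * ennreal (b j)) * ennreal (a i))"
      by (rule int\<nu>)
    also have "\<dots> = (\<Sum>i\<in>I. \<Sum>j\<in>I. ennreal (w i j * cc i j))"
    proof (unfold sum_distrib_right, intro sum.cong refl)
      fix i j assume ij: "i \<in> I" "j \<in> I"
      then show "ennreal (W i j) * ennreal (cc i j) * ennreal (b j) * ennreal (a i) = ennreal (w i j * cc i j)"
        using W0[OF ij] cc0[OF ij] ab0 by (simp add: ennreal_mult[symmetric] Wab[OF ij, symmetric] ac_simps)
    qed
    also have "\<dots> = ennreal (\<Sum>i\<in>I. \<Sum>j\<in>I. w i j * cc i j)"
      using w0 cc0 by (simp add: sum_ennreal sum_nonneg)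
    also have "\<dots> \<le> ennreal (D K + (\<Sum>k<K. D k *
       (\<Sum>Q\<in>L (Suc k). \<bar>measure \<nu> (q (Suc k) -` {Q} \<inter> space N)
                         - measure \<nu>' (q (Suc k) -` {Q} \<inter> space N)\<bar>)))"
    proof (rule ennreal_leI, rule order_trans[OF cost], intro add_mono sum_mono mult_left_mono D0)
      fix k assume k: "k \<in> {..<K}"
      have s: "Suc k \<le> K" using k by simp
      \<comment> \<open>The left sum runs over the labels of cells that occur; passing to all of
        \<open>L (Suc k)\<close> adds nonnegative terms.\<close>
      show "(\<Sum>Q\<in>(\<lambda>i. q (Suc k) (rep i)) ` I.
          \<bar>(\<Sum>i | i \<in> I \<and> q (Suc k) (rep i) = Q. a i) - (\<Sum>i | i \<in> I \<and> q (Suc k) (rep i) = Q. b i)\<bar>)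
        \<le> (\<Sum>Q\<in>L (Suc k). \<bar>measure \<nu> (q (Suc k) -` {Q} \<inter> space N)
                         - measure \<nu>' (q (Suc k) -` {Q} \<inter> space N)\<bar>)"
        unfolding a_def b_def
          cellsum[OF s \<nu>.finite_measure_axioms sets(1)] cellsum[OF s \<nu>'.finite_measure_axioms sets(2)]
        unfolding cell_def using finL qL rep by (intro sum_mono2) auto
    qed (simp add: tot)
    finally show "(\<integral>\<^sup>+x. \<integral>\<^sup>+y. ennreal (W (q K x) (q K y)) * ennreal (c x y) \<partial>\<nu>' \<partial>\<nu>)
      \<le> ennreal (D K + (\<Sum>k<K. D k *
       (\<Sum>Q\<in>L (Suc k). \<bar>measure \<nu> (q (Suc k) -` {Q} \<inter> space N)
                         - measure \<nu>' (q (Suc k) -` {Q} \<inter> space N)\<bar>)))" .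
  qed
qed

text \<open>Gluing along \<open>\<nu>\<close>: draw \<open>(x, u)\<close> from \<open>\<pi>\<close>,
  then \<open>y\<close> with density \<open>w x\<close> relative to \<open>\<nu>'\<close>; the law
  of \<open>(u, y)\<close> is the required coupling. The density plays the part of the conditional
  law of \<open>y\<close> given \<open>x\<close>, and the cost is estimated by passing from
  \<open>u\<close> to \<open>y\<close> through \<open>x\<close>.\<close>

lemma coupling_cost_triangle:
  fixes \<mu> \<nu> \<nu>' N :: "'a::{real_normed_vector, second_countable_topology} measure"
    and w :: "'a \<Rightarrow> 'a \<Rightarrow> ennreal"
  assumes \<mu>: "\<mu> \<in> space (prob_algebra N)" and \<nu>: "\<nu> \<in> space (prob_algebra N)"
    and \<nu>': "\<nu>' \<in> space (prob_algebra N)"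
    and id: "(\<lambda>x. x) \<in> N \<rightarrow>\<^sub>M borel"
    and w[measurable]: "(\<lambda>(x, y). w x y) \<in> borel_measurable (N \<Otimes>\<^sub>M N)"
    and wx: "AE x in \<nu>. (\<integral>\<^sup>+y. w x y \<partial>\<nu>') = 1"
    and wy: "AE y in \<nu>'. (\<integral>\<^sup>+x. w x y \<partial>\<nu>) = 1"
    and \<pi>: "\<pi> \<in> couplings \<nu> \<mu>" and p: "0 \<le> p"
  shows "(INF \<pi>\<in>couplings \<mu> \<nu>'. \<integral>\<^sup>+(x, y). ennreal (norm (x - y) powr p) \<partial>\<pi>)
    \<le> ennreal (2 powr p) * ((\<integral>\<^sup>+(x, y). ennreal (norm (x - y) powr p) \<partial>\<pi>)
        + (\<integral>\<^sup>+x. \<integral>\<^sup>+y. w x y * ennreal (norm (x - y) powr p) \<partial>\<nu>' \<partial>\<nu>))"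
proof -
  have sets[measurable_cong]: "sets \<mu> = sets N" "sets \<nu> = sets N" "sets \<nu>' = sets N"
    using \<mu> \<nu> \<nu>' by (simp_all add: space_prob_algebra)
  interpret \<mu>: prob_space \<mu> using \<mu> by (simp add: space_prob_algebra)
  interpret \<nu>: prob_space \<nu> using \<nu> by (simp add: space_prob_algebra)
  interpret \<nu>': prob_space \<nu>' using \<nu>' by (simp add: space_prob_algebra)
  have "sets \<pi> = sets (\<nu> \<Otimes>\<^sub>M \<mu>)" using \<pi> by (simp add: couplings_def space_prob_algebra)
  also have "\<dots> = sets (N \<Otimes>\<^sub>M N)" by (intro sets_pair_measure_cong sets)
  finally have s\<pi>[measurable_cong]: "sets \<pi> = sets (N \<Otimes>\<^sub>M N)" .
  interpret \<pi>: prob_space \<pi> using \<pi> by (simp add: couplings_def space_prob_algebra)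
  have m1: "distr \<pi> \<nu> fst = \<nu>" and m2: "distr \<pi> \<mu> snd = \<mu>"
    using \<pi> by (simp_all add: couplings_def)
  have wsec: "w x \<in> borel_measurable N" if "x \<in> space N" for x
    using measurable_Pair2[OF w that] by simp
  have wsec': "(\<lambda>x. w x y) \<in> borel_measurable N" if "y \<in> space N" for y
    using measurable_Pair1[OF w that] by simp
  have fst_N: "fst z \<in> space N" if "z \<in> space \<pi>" for z
    using that unfolding sets_eq_imp_space_eq[OF s\<pi>] by (simp add: space_pair_measure mem_Times_iff)
  interpret pp: pair_sigma_finite \<nu> \<nu>' ..
  have wx': "AE z in \<pi>. (\<integral>\<^sup>+y. w (fst z) y \<partial>\<nu>') = 1"
  proof (rule AE_distrD[where M' = \<nu> and f = fst])
    show "AE x in distr \<pi> \<nu> fst. (\<integral>\<^sup>+y. w x y \<partial>\<nu>') = 1"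
      unfolding m1 by (rule wx)
  qed measurable
  have int_fst: "(\<integral>\<^sup>+z. f (fst z) \<partial>\<pi>) = (\<integral>\<^sup>+x. f x \<partial>\<nu>)"
    if [measurable]: "f \<in> borel_measurable N" for f
    by (subst m1[symmetric], subst nn_integral_distr) auto
  have int_snd: "(\<integral>\<^sup>+z. f (snd z) \<partial>\<pi>) = (\<integral>\<^sup>+x. f x \<partial>\<mu>)"
    if [measurable]: "f \<in> borel_measurable N" for f
    by (subst m2[symmetric], subst nn_integral_distr) auto
  define T where "T = distr (density (\<pi> \<Otimes>\<^sub>M \<nu>') (\<lambda>(z, y). w (fst z) y)) (\<mu> \<Otimes>\<^sub>M \<nu>')
    (\<lambda>(z, y). (snd z, y))"
  have intT: "(\<integral>\<^sup>+v. f v \<partial>T) = (\<integral>\<^sup>+z. \<integral>\<^sup>+y. w (fst z) y * f (snd z, y) \<partial>\<nu>' \<partial>\<pi>)"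
    if [measurable]: "f \<in> borel_measurable (N \<Otimes>\<^sub>M N)" for f
  proof -
    have [measurable]: "(\<lambda>(z, y). (snd z, y)) \<in> \<pi> \<Otimes>\<^sub>M \<nu>' \<rightarrow>\<^sub>M \<mu> \<Otimes>\<^sub>M \<nu>'"
      "(\<lambda>(z, y). w (fst z) y) \<in> borel_measurable (\<pi> \<Otimes>\<^sub>M \<nu>')" by measurable
    show ?thesis
      unfolding T_def
      by (simp add: nn_integral_distr nn_integral_density case_prod_beta'
        flip: \<nu>'.nn_integral_fst)
  qed
  have Tfst: "distr T \<mu> fst = \<mu>"
  proof (rule measure_eqI)
    fix A assume "A \<in> sets (distr T \<mu> fst)"
    then have A[measurable]: "A \<in> sets N" by (simp add: sets)
    have [measurable]: "fst \<in> T \<rightarrow>\<^sub>M \<mu>" by (simp add: T_def)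
    have "emeasure (distr T \<mu> fst) A = (\<integral>\<^sup>+v. indicator A v \<partial>distr T \<mu> fst)"
      by (simp add: sets)
    also have "\<dots> = (\<integral>\<^sup>+v. indicator A (fst v) \<partial>T)"
      by (rule nn_integral_distr) measurable
    also have "\<dots> = (\<integral>\<^sup>+z. \<integral>\<^sup>+y. w (fst z) y * indicator A (snd z) \<partial>\<nu>' \<partial>\<pi>)"
      by (subst intT) auto
    also have "\<dots> = (\<integral>\<^sup>+z. (\<integral>\<^sup>+y. w (fst z) y \<partial>\<nu>') * indicator A (snd z) \<partial>\<pi>)"
      using wsec[OF fst_N] by (intro nn_integral_cong nn_integral_multc) (simp add: measurable_cong_sets[OF sets(3) refl])
    also have "\<dots> = (\<integral>\<^sup>+z. indicator A (snd z) \<partial>\<pi>)"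
      using wx' by (intro nn_integral_cong_AE) auto
    also have "\<dots> = emeasure \<mu> A" by (subst int_snd) (auto simp: sets)
    finally show "emeasure (distr T \<mu> fst) A = emeasure \<mu> A" .
  qed simp
  have Tsnd: "distr T \<nu>' snd = \<nu>'"
  proof (rule measure_eqI)
    fix A assume "A \<in> sets (distr T \<nu>' snd)"
    then have A[measurable]: "A \<in> sets N" by (simp add: sets)
    have [measurable]: "snd \<in> T \<rightarrow>\<^sub>M \<nu>'" by (simp add: T_def)
    have "emeasure (distr T \<nu>' snd) A = (\<integral>\<^sup>+v. indicator A v \<partial>distr T \<nu>' snd)"
      by (simp add: sets)
    also have "\<dots> = (\<integral>\<^sup>+v. indicator A (snd v) \<partial>T)"
      by (rule nn_integral_distr) measurable
    also have "\<dots> = (\<integral>\<^sup>+z. \<integral>\<^sup>+y. w (fst z) y * indicator A y \<partial>\<nu>' \<partial>\<pi>)"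
      by (subst intT) auto
    also have "\<dots> = (\<integral>\<^sup>+x. \<integral>\<^sup>+y. w x y * indicator A y \<partial>\<nu>' \<partial>\<nu>)"
      by (rule int_fst) measurable
    \<comment> \<open>Exchanging the order of integration brings the other marginal condition
      \<open>wy\<close> into play.\<close>
    also have "\<dots> = (\<integral>\<^sup>+y. \<integral>\<^sup>+x. w x y * indicator A y \<partial>\<nu> \<partial>\<nu>')"
      by (rule pp.Fubini'[symmetric]) measurable
    also have "\<dots> = (\<integral>\<^sup>+y. (\<integral>\<^sup>+x. w x y \<partial>\<nu>) * indicator A y \<partial>\<nu>')"
      using wsec' sets_eq_imp_space_eq[OF sets(3)]
      by (intro nn_integral_cong nn_integral_multc) (simp add: measurable_cong_sets[OF sets(2) refl])
    also have "\<dots> = (\<integral>\<^sup>+y. indicator A y \<partial>\<nu>')"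
      using wy by (intro nn_integral_cong_AE) auto
    also have "\<dots> = emeasure \<nu>' A" by (simp add: sets)
    finally show "emeasure (distr T \<nu>' snd) A = emeasure \<nu>' A" .
  qed simp
  \<comment> \<open>\<open>T\<close> inherits total mass 1 from its first marginal.\<close>
  have "prob_space (distr T \<mu> fst)" unfolding Tfst by (rule \<mu>.prob_space_axioms)
  then have "prob_space T" by (rule prob_space_distrD[rotated]) (simp add: T_def)
  then have T: "T \<in> couplings \<mu> \<nu>'"
    using Tfst Tsnd by (simp add: couplings_def space_prob_algebra T_def)
  define d where "d x y = ennreal (norm (x - y) powr p)" for x y :: 'a
  have d[measurable]: "(\<lambda>(x, y). d x y) \<in> borel_measurable (N \<Otimes>\<^sub>M N)"
  proof -
    have [measurable]: "fst \<in> N \<Otimes>\<^sub>M N \<rightarrow>\<^sub>M borel" "snd \<in> N \<Otimes>\<^sub>M N \<rightarrow>\<^sub>M borel"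
      by (rule measurable_compose[OF measurable_fst id], rule measurable_compose[OF measurable_snd id])
    show ?thesis unfolding d_def case_prod_beta' by measurable
  qed
  have tri: "d u y \<le> ennreal (2 powr p) * (d x u + d x y)" for u x y
  proof -
    have "norm (u - y) \<le> norm (x - u) + norm (x - y)"
      using norm_triangle_ineq4[of "x - y" "x - u"] by (simp add: norm_minus_commute)
    also have "\<dots> \<le> 2 * max (norm (x - u)) (norm (x - y))" by simp
    finally have "norm (u - y) powr p \<le> (2 * max (norm (x - u)) (norm (x - y))) powr p"
      using p by (intro powr_mono2) auto
    also have "\<dots> = 2 powr p * max (norm (x - u)) (norm (x - y)) powr p"
      by (simp add: powr_mult)
    also have "\<dots> \<le> 2 powr p * (norm (x - u) powr p + norm (x - y) powr p)"
      by (intro mult_left_mono) (auto simp: max_def)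
    finally show ?thesis
      unfolding d_def by (simp add: ennreal_mult'[symmetric] ennreal_plus[symmetric] del: ennreal_plus)
  qed
  have wd_meas: "(\<lambda>x. \<integral>\<^sup>+y. w x y * d x y \<partial>\<nu>') \<in> borel_measurable N"
    by measurable
  have "(INF \<pi>\<in>couplings \<mu> \<nu>'. \<integral>\<^sup>+(x, y). d x y \<partial>\<pi>) \<le> (\<integral>\<^sup>+(x, y). d x y \<partial>T)"
    using T by (rule INF_lower)
  also have "\<dots> = (\<integral>\<^sup>+z. \<integral>\<^sup>+y. w (fst z) y * d (snd z) y \<partial>\<nu>' \<partial>\<pi>)"
    by (subst intT) auto
  also have "\<dots> \<le> (\<integral>\<^sup>+z. \<integral>\<^sup>+y. ennreal (2 powr p) *
      (w (fst z) y * d (fst z) (snd z) + w (fst z) y * d (fst z) y) \<partial>\<nu>' \<partial>\<pi>)"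
  proof (intro nn_integral_mono)
    fix z y
    have "w (fst z) y * d (snd z) y
        \<le> w (fst z) y * (ennreal (2 powr p) * (d (fst z) (snd z) + d (fst z) y))"
      by (intro mult_left_mono tri) simp
    then show "w (fst z) y * d (snd z) y \<le> ennreal (2 powr p) *
      (w (fst z) y * d (fst z) (snd z) + w (fst z) y * d (fst z) y)"
      by (simp add: distrib_left ac_simps)
  qed
  also have "\<dots> = (\<integral>\<^sup>+z. ennreal (2 powr p) * ((\<integral>\<^sup>+y. w (fst z) y \<partial>\<nu>') * d (fst z) (snd z)
      + (\<integral>\<^sup>+y. w (fst z) y * d (fst z) y \<partial>\<nu>')) \<partial>\<pi>)"
  proof (intro nn_integral_cong)
    fix z assume "z \<in> space \<pi>"
    then have [measurable]: "w (fst z) \<in> borel_measurable \<nu>'" "d (fst z) \<in> borel_measurable \<nu>'"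
      using wsec measurable_Pair2[OF d] fst_N by (simp_all add: measurable_cong_sets[OF sets(3) refl])
    show "(\<integral>\<^sup>+y. ennreal (2 powr p) *
      (w (fst z) y * d (fst z) (snd z) + w (fst z) y * d (fst z) y) \<partial>\<nu>')
      = ennreal (2 powr p) * ((\<integral>\<^sup>+y. w (fst z) y \<partial>\<nu>') * d (fst z) (snd z)
      + (\<integral>\<^sup>+y. w (fst z) y * d (fst z) y \<partial>\<nu>'))"
      by (simp add: nn_integral_cmult nn_integral_add nn_integral_multc)
  qed
  \<comment> \<open>The cost under \<open>\<pi>\<close> does not involve \<open>y\<close>, so the
    density integrates out to 1.\<close>
  also have "\<dots> = (\<integral>\<^sup>+z. ennreal (2 powr p) * (d (fst z) (snd z)
      + (\<integral>\<^sup>+y. w (fst z) y * d (fst z) y \<partial>\<nu>')) \<partial>\<pi>)"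
    using wx' by (intro nn_integral_cong_AE) auto
  also have "\<dots> = ennreal (2 powr p) * ((\<integral>\<^sup>+z. d (fst z) (snd z) \<partial>\<pi>)
      + (\<integral>\<^sup>+z. \<integral>\<^sup>+y. w (fst z) y * d (fst z) y \<partial>\<nu>' \<partial>\<pi>))"
  proof -
    have [measurable]: "(\<lambda>z. d (fst z) (snd z)) \<in> borel_measurable \<pi>"
      using d by (simp add: case_prod_beta' measurable_cong_sets[OF s\<pi> refl])
    have [measurable]: "(\<lambda>z. \<integral>\<^sup>+y. w (fst z) y * d (fst z) y \<partial>\<nu>') \<in> borel_measurable \<pi>"
      by (rule measurable_compose[OF _ wd_meas, of fst]) measurable
    show ?thesis by (simp add: nn_integral_cmult nn_integral_add)
  qed
  also have "(\<integral>\<^sup>+z. \<integral>\<^sup>+y. w (fst z) y * d (fst z) y \<partial>\<nu>' \<partial>\<pi>) = (\<integral>\<^sup>+x. \<integral>\<^sup>+y. w x y * d x y \<partial>\<nu>' \<partial>\<nu>)"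
    by (rule int_fst[OF wd_meas])
  finally show ?thesis by (simp add: d_def case_prod_beta')
qed

section \<open>Sampling and dyadic cells\<close>

text \<open>The off-diagonal terms of the expanded square factor by independence and vanish because
  \<open>h\<close> has mean 0; the bound \<open>B\<close> gives integrability.\<close>

lemma (in prob_space) integral_square_iid_sum:
  fixes h :: "'a \<Rightarrow> real"
  assumes h[measurable]: "h \<in> borel_measurable M" and bnd: "\<And>x. \<bar>h x\<bar> \<le> B"
    and mean: "expectation h = 0"
  shows "integrable (iid_sample m M) (\<lambda>z. (\<Sum>j<m. h (z j))\<^sup>2)"
    and "(\<integral>z. (\<Sum>j<m. h (z j))\<^sup>2 \<partial>iid_sample m M) = real m * expectation (\<lambda>x. (h x)\<^sup>2)"
proof -
  interpret P: product_prob_space "\<lambda>_. M" "{..<m}"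
    by unfold_locales
  have B0: "0 \<le> B" using bnd[of undefined] by simp
  have int: "integrable M h" by (rule integrable_const_bound[of _ B]) (use bnd in auto)
  have int2: "integrable M (\<lambda>x. (h x)\<^sup>2)"
    by (rule integrable_const_bound[of _ "B\<^sup>2"]) (use bnd B0 in \<open>auto simp: abs_le_square_iff[symmetric]\<close>)
  \<comment> \<open>Writes \<open>h (z i) * h (z j)\<close> as a product over all coordinates, with
    factor 1 elsewhere, so that the product formula for integrals applies. On the diagonal,
    coordinate \<open>i\<close> carries the square.\<close>
  define F where "F i j k = (if i = j then if k = i then (\<lambda>x. (h x)\<^sup>2) else (\<lambda>_. 1)
      else if k = i \<or> k = j then h else (\<lambda>_. 1))" for i j k :: nat
  have intF: "integrable M (F i j k)" for i j k using int int2 by (auto simp: F_def)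
  have prodF: "(\<Prod>k<m. F i j k (z k)) = h (z i) * h (z j)" if "i < m" "j < m" for i j and z :: "nat \<Rightarrow> 'a"
  proof -
    have "(\<Prod>k<m. F i j k (z k)) = (\<Prod>k\<in>{i, j}. F i j k (z k))"
      by (rule prod.mono_neutral_right) (use that in \<open>auto simp: F_def\<close>)
    then show ?thesis by (cases "i = j") (auto simp: F_def power2_eq_square)
  qed
  have int_prod: "integrable (PiM {..<m} (\<lambda>_. M)) (\<lambda>z. h (z i) * h (z j))" if "i < m" "j < m" for i j
    using P.product_integrable_prod[of "{..<m}" "F i j"] intF prodF[OF that] by simp
  have ex: "(\<integral>z. h (z i) * h (z j) \<partial>PiM {..<m} (\<lambda>_. M)) = (if i = j then expectation (\<lambda>x. (h x)\<^sup>2) else 0)"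
    if "i < m" "j < m" for i j
  proof -
    have "(\<integral>z. h (z i) * h (z j) \<partial>PiM {..<m} (\<lambda>_. M)) = (\<Prod>k<m. expectation (F i j k))"
      using P.product_integral_prod[of "{..<m}" "F i j"] intF prodF[OF that] by simp
    also have "\<dots> = (\<Prod>k\<in>{i, j}. expectation (F i j k))"
      by (rule prod.mono_neutral_right) (use that in \<open>auto simp: F_def prob_space\<close>)
    finally show ?thesis by (cases "i = j") (auto simp: F_def mean)
  qed
  have sq: "(\<Sum>j<m. h (z j))\<^sup>2 = (\<Sum>i<m. \<Sum>j<m. h (z i) * h (z j))" for z :: "nat \<Rightarrow> 'a"
    by (simp add: power2_eq_square sum_product)
  show "integrable (iid_sample m M) (\<lambda>z. (\<Sum>j<m. h (z j))\<^sup>2)"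
    unfolding iid_sample_def sq by (intro Bochner_Integration.integrable_sum int_prod) auto
  show "(\<integral>z. (\<Sum>j<m. h (z j))\<^sup>2 \<partial>iid_sample m M) = real m * expectation (\<lambda>x. (h x)\<^sup>2)"
  proof -
    have "(\<integral>z. (\<Sum>i<m. \<Sum>j<m. h (z i) * h (z j)) \<partial>PiM {..<m} (\<lambda>_. M))
        = (\<Sum>i<m. \<integral>z. (\<Sum>j<m. h (z i) * h (z j)) \<partial>PiM {..<m} (\<lambda>_. M))"
      by (intro Bochner_Integration.integral_sum Bochner_Integration.integrable_sum int_prod) auto
    also have "\<dots> = (\<Sum>i<m. \<Sum>j<m. \<integral>z. h (z i) * h (z j) \<partial>PiM {..<m} (\<lambda>_. M))"
      by (intro sum.cong refl Bochner_Integration.integral_sum int_prod) auto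
    also have "\<dots> = (\<Sum>i<m. \<Sum>j<m. if i = j then expectation (\<lambda>x. (h x)\<^sup>2) else 0)"
      by (intro sum.cong refl ex) auto
    finally show ?thesis unfolding iid_sample_def sq by simp
  qed
qed

text \<open>The empirical frequency of a cell has variance at most
  \<open>measure M (C Q) / m\<close>. Disjointness makes these sum to at most \<open>1 / m\<close>,
  and Cauchy-Schwarz over the cells contributes the factor \<open>card L\<close>.\<close>

lemma (in prob_space) expected_cell_discrepancy:
  fixes C :: "'c \<Rightarrow> 'a set"
  assumes fin: "finite L" and C[measurable]: "\<And>Q. Q \<in> L \<Longrightarrow> C Q \<in> sets M"
    and disj: "disjoint_family_on C L" and m: "0 < m"
  shows "(\<integral>\<^sup>+z. ennreal (\<Sum>Q\<in>L. \<bar>measure M (C Q) - (\<Sum>j<m. indicator (C Q) (z j)) / real m\<bar>)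
      \<partial>iid_sample m M) \<le> ennreal (sqrt (real (card L) / real m))"
proof (cases "L = {}")
  case False
  \<comment> \<open>The target bound. The square root is taken by the linear estimate
    \<open>2 * S z \<le> (S z)\<^sup>2 / s + s\<close>, where both terms on the right have mean at
    most \<open>s\<close>. Without cells \<open>s\<close> would be 0, so that case is split
    off.\<close>
  define s where "s = sqrt (real (card L) / real m)"
  have cL: "0 < real (card L)" using False fin by (simp add: card_gt_0_iff)
  have s0: "0 < s" using cL m by (simp add: s_def)
  have s2: "s\<^sup>2 = real (card L) / real m" by (simp add: s_def)
  define h where "h Q x = indicator (C Q) x - measure M (C Q)" for Q x
  define S where "S z = (\<Sum>Q\<in>L. \<bar>measure M (C Q) - (\<Sum>j<m. indicator (C Q) (z j)) / real m\<bar>)"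
    for z :: "nat \<Rightarrow> 'a"
  define V where "V z = (\<Sum>Q\<in>L. (\<Sum>j<m. h Q (z j))\<^sup>2)" for z :: "nat \<Rightarrow> 'a"
  have hm: "h Q \<in> borel_measurable M" if "Q \<in> L" for Q
    using C[OF that] unfolding h_def by measurable
  have hb: "\<bar>h Q x\<bar> \<le> 1" for Q x
    using prob_le_1[of "C Q"] measure_nonneg[of M "C Q"]
    by (cases "x \<in> C Q") (simp_all add: h_def abs_le_iff)
  have ind: "integrable M (indicator (C Q) :: 'a \<Rightarrow> real)" if "Q \<in> L" for Q
    using C[OF that] by (intro integrable_real_indicator) (auto simp: less_top[symmetric])
  have hz: "expectation (h Q) = 0" if "Q \<in> L" for Q
    using ind[OF that] C[OF that] by (simp add: h_def[abs_def] prob_space)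
  have hv: "expectation (\<lambda>x. (h Q x)\<^sup>2) \<le> measure M (C Q)" if "Q \<in> L" for Q
  proof -
    have eq: "(h Q x)\<^sup>2 = (1 - 2 * measure M (C Q)) * indicator (C Q) x + (measure M (C Q))\<^sup>2" for x
      by (auto simp: h_def indicator_def power2_eq_square algebra_simps)
    have "expectation (\<lambda>x. (h Q x)\<^sup>2) = (1 - 2 * measure M (C Q)) * measure M (C Q) + (measure M (C Q))\<^sup>2"
      unfolding eq using ind[OF that] C[OF that] by (simp add: prob_space)
    also have "\<dots> = measure M (C Q) - (measure M (C Q))\<^sup>2"
      by (simp add: power2_eq_square algebra_simps)
    finally show ?thesis by simp
  qed
  interpret I: prob_space "iid_sample m M"
    unfolding iid_sample_def by (intro prob_space_PiM prob_space_axioms)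
  have Vint: "integrable (iid_sample m M) V"
    unfolding V_def by (intro Bochner_Integration.integrable_sum integral_square_iid_sum(1)[OF hm hb hz])
  have "(\<integral>z. V z \<partial>iid_sample m M) = (\<Sum>Q\<in>L. real m * expectation (\<lambda>x. (h Q x)\<^sup>2))"
    unfolding V_def
    by (subst Bochner_Integration.integral_sum)
       (auto intro!: integral_square_iid_sum[OF hm hb hz] sum.cong)
  also have "\<dots> \<le> (\<Sum>Q\<in>L. real m * measure M (C Q))"
    by (intro sum_mono mult_left_mono hv) auto
  also have "\<dots> = real m * measure M (\<Union>Q\<in>L. C Q)"
    using fin C disj by (subst finite_measure_finite_Union) (auto simp: sum_distrib_left)
  also have "\<dots> \<le> real m" by (simp add: mult_left_le)
  finally have EV: "(\<integral>z. V z \<partial>iid_sample m M) \<le> real m" .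
  have SV: "S z \<le> (real (card L) / (real m)\<^sup>2 / s) / 2 * V z + s / 2" for z
  proof -
    have eq: "measure M (C Q) - (\<Sum>j<m. indicator (C Q) (z j)) / real m = - ((\<Sum>j<m. h Q (z j)) / real m)" for Q
      using m by (simp add: h_def sum_subtractf field_simps)
    have "(S z)\<^sup>2 \<le> (\<Sum>Q\<in>L. \<bar>(\<Sum>j<m. h Q (z j)) / real m\<bar>\<^sup>2) * real (card L)"
      unfolding S_def eq abs_minus_cancel by (rule sum_squared_le_sum_of_squares)
    also have "(\<Sum>Q\<in>L. \<bar>(\<Sum>j<m. h Q (z j)) / real m\<bar>\<^sup>2) = V z / (real m)\<^sup>2"
      by (simp add: V_def power_divide flip: sum_divide_distrib)
    finally have "(S z)\<^sup>2 / s \<le> V z / (real m)\<^sup>2 * real (card L) / s"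
      using s0 by (intro divide_right_mono) auto
    moreover have "2 * S z \<le> (S z)\<^sup>2 / s + s"
      using s0 zero_le_power2[of "S z - s"] by (simp add: field_simps power2_eq_square)
    ultimately show ?thesis by (simp add: field_simps)
  qed
  have V0: "0 \<le> V z" for z by (simp add: V_def sum_nonneg)
  have "(\<integral>\<^sup>+z. ennreal (S z) \<partial>iid_sample m M)
      \<le> (\<integral>\<^sup>+z. ennreal ((real (card L) / (real m)\<^sup>2 / s) / 2 * V z + s / 2) \<partial>iid_sample m M)"
    by (intro nn_integral_mono ennreal_leI SV)
  also have "\<dots> = ennreal (\<integral>z. ((real (card L) / (real m)\<^sup>2 / s) / 2 * V z + s / 2) \<partial>iid_sample m M)"
    using Vint V0 s0 by (intro nn_integral_eq_integral) auto
  also have "\<dots> = ennreal ((real (card L) / (real m)\<^sup>2 / s) / 2 * (\<integral>z. V z \<partial>iid_sample m M) + s / 2)"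
    using Vint by (simp add: I.prob_space)
  also have "\<dots> \<le> ennreal ((real (card L) / (real m)\<^sup>2 / s) / 2 * real m + s / 2)"
    using EV s0 by (intro ennreal_leI add_mono mult_left_mono) auto
  also have "(real (card L) / (real m)\<^sup>2 / s) / 2 * real m + s / 2 = s"
  proof -
    have "real (card L) = s\<^sup>2 * real m" using s2 m by simp
    then show ?thesis using s0 m by (simp add: field_simps power2_eq_square)
  qed
  finally show ?thesis by (simp add: S_def s_def)
qed simp

section \<open>Empirical measures as probability measures\<close>

lemma measure_empirical:
  assumes "m > 0" "\<And>i. i < m \<Longrightarrow> z i \<in> space N" "A \<in> sets N"
  shows "measure (empirical N m z) A = (\<Sum>j<m. indicator A (z j)) / real m"
proof -
  have "emeasure (empirical N m z) A = (\<Sum>j<m. indicator A (z j)) / of_nat m"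
    using emeasure_empirical[OF assms] assms by simp
  also have "\<dots> = ennreal ((\<Sum>j<m. indicator A (z j)) / real m)"
  proof -
    have "(\<Sum>j<m. indicator A (z j)) = (\<Sum>j<m. ennreal (indicator A (z j)))"
      by (simp only: ennreal_indicator)
    also have "\<dots> = ennreal (\<Sum>j<m. indicator A (z j))" by (rule sum_ennreal) simp
    finally show ?thesis
      using assms(1) by (simp only: ennreal_of_nat_eq_real_of_nat) (simp add: divide_ennreal sum_nonneg)
  qed
  finally show ?thesis unfolding measure_def by (simp add: sum_nonneg)
qed

lemma empirical_in_prob_algebra:
  assumes "m > 0" "\<And>i. i < m \<Longrightarrow> z i \<in> space N"
  shows "empirical N m z \<in> space (prob_algebra N)"
proof -
  have "prob_space (uniform_count_measure {..<m})"
    using assms(1) by (intro prob_space_uniform_count_measure) auto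
  moreover have "z \<in> uniform_count_measure {..<m} \<rightarrow>\<^sub>M N"
    using assms(2) by (auto simp: measurable_def sets_uniform_count_measure space_uniform_count_measure)
  ultimately show ?thesis
    by (simp add: empirical_def space_prob_algebra prob_space.prob_space_distr)
qed

section \<open>Dyadic cells of the cube\<close>

text \<open>Halving the coordinates makes level \<open>0\<close> a single cell even though the cube is closed.\<close>

definition dyadic_label :: "nat \<Rightarrow> real ^ 'd \<Rightarrow> 'd \<Rightarrow> int" where
  "dyadic_label k x = (\<lambda>i. \<lfloor>2 ^ k * x $ i / 2\<rfloor>)"

text \<open>The upper end is the label of coordinate 1. For \<open>k\<close> at least 1 this makes
  \<open>2 ^ (k - 1) + 1\<close> labels per coordinate; at level 0 the integer division leaves only
  0.\<close>

definition dyadic_labels :: "nat \<Rightarrow> ('d::finite \<Rightarrow> int) set" where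
  "dyadic_labels k = PiE UNIV (\<lambda>_. {0..2 ^ k div 2})"

lemma space_cube: "space cube = {x::real ^ 'd. \<forall>i. 0 \<le> x $ i \<and> x $ i \<le> 1}"
  by (simp add: cube_def space_restrict_space)

lemma finite_dyadic_labels: "finite (dyadic_labels k)"
  unfolding dyadic_labels_def by (intro finite_PiE) auto

lemma card_dyadic_labels: "card (dyadic_labels k :: ('d::finite \<Rightarrow> int) set) \<le> 2 ^ (k * CARD('d))"
proof -
  have "card (dyadic_labels k :: ('d \<Rightarrow> int) set) = card {0..2 ^ k div 2::int} ^ CARD('d)"
    by (simp add: dyadic_labels_def card_PiE)
  also have "card {0..2 ^ k div 2::int} \<le> 2 ^ k"
  proof (cases k)
    case (Suc j)
    \<comment> \<open>The additional label, for coordinate 1, is absorbed by the halving.\<close>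
    have "nat (2 ^ j + 1) \<le> 2 * 2 ^ j"
      using one_le_power[of "2::int" j] by (simp add: nat_le_iff)
    with Suc show ?thesis by simp
  qed simp
  then have "card {0..2 ^ k div 2::int} ^ CARD('d) \<le> (2 ^ k) ^ CARD('d)" by (rule power_mono) simp
  finally show ?thesis by (simp add: power_mult)
qed

lemma dyadic_label_mem:
  assumes "x \<in> space cube"
  shows "dyadic_label k x \<in> dyadic_labels k"
proof -
  have "0 \<le> \<lfloor>2 ^ k * x $ i / 2\<rfloor>" "\<lfloor>2 ^ k * x $ i / 2\<rfloor> \<le> 2 ^ k div 2" for i
  proof -
    have x: "0 \<le> x $ i" "x $ i \<le> 1" using assms by (auto simp: space_cube)
    show "0 \<le> \<lfloor>2 ^ k * x $ i / 2\<rfloor>" using x by simp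
    have "\<lfloor>2 ^ k * x $ i / 2\<rfloor> \<le> \<lfloor>2 ^ k / 2 :: real\<rfloor>"
      using x by (intro floor_mono divide_right_mono) (auto simp: mult_left_le)
    also have "\<dots> = 2 ^ k div 2"
      using floor_divide_of_int_eq[of "2 ^ k" 2, where 'a = real] by simp
    finally show "\<lfloor>2 ^ k * x $ i / 2\<rfloor> \<le> 2 ^ k div 2" .
  qed
  then show ?thesis by (simp add: dyadic_labels_def dyadic_label_def PiE_UNIV_domain)
qed

lemma measurable_dyadic_label:
  "dyadic_label k \<in> (cube :: (real ^ 'd) measure) \<rightarrow>\<^sub>M count_space (dyadic_labels k)"
proof (subst measurable_count_space_eq2[OF finite_dyadic_labels], intro conjI ballI)
  show "dyadic_label k \<in> space (cube :: (real ^ 'd) measure) \<rightarrow> dyadic_labels k" using dyadic_label_mem by blast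
  have [measurable]: "(\<lambda>x. x) \<in> cube \<rightarrow>\<^sub>M (borel :: (real ^ 'd) measure)"
    unfolding cube_def by (rule measurable_restrict_space1) simp
  have [measurable]: "(\<lambda>x. x $ i) \<in> (cube :: (real ^ 'd) measure) \<rightarrow>\<^sub>M borel" for i :: 'd
    by (rule measurable_compose[of "\<lambda>x. x" _ borel])
       (auto intro!: borel_measurable_continuous_onI continuous_intros)
  fix a :: "'d \<Rightarrow> int"
  have "dyadic_label k -` {a} \<inter> space cube = {x\<in>space cube. \<forall>i\<in>UNIV. \<lfloor>2 ^ k * x $ i / 2\<rfloor> = a i}"
    by (auto simp: dyadic_label_def)
  also have "\<dots> \<in> sets cube" by measurable
  finally show "dyadic_label k -` {a} \<inter> space cube \<in> sets cube" .
qed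

lemma dyadic_label_root:
  assumes "x \<in> space cube" "y \<in> space cube"
  shows "dyadic_label 0 x = dyadic_label 0 y"
  using dyadic_label_mem[OF assms(1), of 0] dyadic_label_mem[OF assms(2), of 0]
  by (auto simp: dyadic_labels_def PiE_UNIV_domain Pi_iff fun_eq_iff)

lemma dyadic_label_nested:
  assumes "dyadic_label (Suc k) x = dyadic_label (Suc k) y"
  shows "dyadic_label k x = dyadic_label k y"
proof -
  \<comment> \<open>The label of the parent cell is that of the child \<open>div 2\<close> in each
    coordinate.\<close>
  have "dyadic_label k v = (\<lambda>i. dyadic_label (Suc k) v i div 2)" for v :: "real ^ 'a"
  proof
    fix i
    have "\<lfloor>2 ^ k * v $ i / 2\<rfloor> = \<lfloor>2 ^ Suc k * v $ i / 2 / real_of_int 2\<rfloor>" by simp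
    also have "\<dots> = \<lfloor>2 ^ Suc k * v $ i / 2\<rfloor> div 2" by (rule floor_divide_real_eq_div) simp
    finally show "dyadic_label k v i = dyadic_label (Suc k) v i div 2" by (simp add: dyadic_label_def)
  qed
  with assms show ?thesis by simp
qed

text \<open>Equal floors leave a gap of at most \<open>2 / 2 ^ k\<close> in each coordinate, the 2
  coming from the halving. The sum norm dominates the Euclidean norm and contributes
  \<open>CARD('d)\<close>.\<close>

lemma dyadic_label_dist:
  fixes x y :: "real ^ 'd"
  assumes "dyadic_label k x = dyadic_label k y"
  shows "norm (x - y) \<le> 2 * real CARD('d) / 2 ^ k"
proof -
  have "\<bar>(x - y) $ i\<bar> \<le> 2 / 2 ^ k" for i
  proof -
    have "\<lfloor>2 ^ k * x $ i / 2\<rfloor> = \<lfloor>2 ^ k * y $ i / 2\<rfloor>"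
      using assms by (simp add: dyadic_label_def fun_eq_iff)
    then have "\<bar>2 ^ k * x $ i / 2 - 2 ^ k * y $ i / 2\<bar> \<le> 1" by linarith
    also have "2 ^ k * x $ i / 2 - 2 ^ k * y $ i / 2 = (2 ^ k / 2) * (x - y) $ i"
      by (simp add: algebra_simps)
    finally have "(2 ^ k / 2) * \<bar>(x - y) $ i\<bar> \<le> 1" by (simp only: abs_mult) simp
    then show ?thesis by (simp add: field_simps)
  qed
  then have "(\<Sum>i\<in>UNIV. \<bar>(x - y) $ i\<bar>) \<le> (\<Sum>i\<in>(UNIV::'d set). 2 / 2 ^ k)" by (rule sum_mono)
  with norm_le_l1_cart[of "x - y"] show ?thesis by (simp add: mult.commute)
qed

section \<open>The resampling rate\<close>

text \<open>Here \<open>n\<close> is the dimension. The terms grow geometrically with ratio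
  \<open>2 powr (n / 2 - p)\<close>, which exceeds 1 as \<open>n > 2 * p\<close>, so the sum is of
  the order of its last term. With \<open>2 ^ K\<close> within a factor 2 below
  \<open>m powr (1 / n)\<close>, both summands have order \<open>m powr (- p / n)\<close>.\<close>

lemma dyadic_sum_bound:
  fixes p :: real and n :: nat
  assumes p: "1 \<le> p" and n: "real n > 2 * p"
  obtains C where "C > 0"
    "\<And>m. m \<ge> 1 \<Longrightarrow> \<exists>K. (2 * real n / 2 ^ K) powr p
        + (\<Sum>k<K. (2 * real n / 2 ^ k) powr p * sqrt (2 ^ (Suc k * n) / real m))
      \<le> C * real m powr (- p / real n)"
proof -
  define \<delta> where "\<delta> = real n"
  have \<delta>: "\<delta> > 2 * p" "\<delta> > 0" using p n by (auto simp: \<delta>_def)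
  define r where "r = 2 powr (\<delta> / 2 - p)"
  have r1: "1 < r" using \<delta> by (simp add: r_def)
  \<comment> \<open>Collects the factors of a summand that depend neither on \<open>k\<close> nor on
    \<open>m\<close>.\<close>
  define B where "B = (2 * \<delta>) powr p * 2 powr (\<delta> / 2)"
  have B0: "0 < B" using \<delta> by (simp add: B_def)
  show ?thesis
  \<comment> \<open>The first constant comes from \<open>2 ^ K > M / 2\<close>, which doubles
    \<open>2 * \<delta>\<close>; the second is that of the geometric sum.\<close>
  proof (rule that[of "(4 * \<delta>) powr p + B / (r - 1)"])
    show "0 < (4 * \<delta>) powr p + B / (r - 1)" using \<delta> r1 B0 by (intro add_pos_pos) auto
  next
    fix m :: nat assume m: "1 \<le> m"
    define M where "M = real m powr (1 / \<delta>)"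
    have M1: "1 \<le> M" using m \<delta> by (simp add: M_def ge_one_powr_ge_zero)
    define K where "K = nat \<lfloor>log 2 M\<rfloor>"
    have l0: "0 \<le> log 2 M" using M1 by simp
    have K: "real K \<le> log 2 M" "log 2 M < real K + 1" using l0 by (auto simp: K_def)
    have KM: "2 ^ K \<le> M" "M < 2 * 2 ^ K"
      using K M1 by (simp_all add: le_log_iff log_less_iff powr_realpow powr_add)
    have mM: "real m powr (- p / \<delta>) = M powr (- p)" "real m powr (- (1/2)) = M powr (- \<delta> / 2)"
      using \<delta> by (simp_all add: M_def powr_powr)
    have D: "(2 * \<delta> / 2 ^ k) powr p = (2 * \<delta>) powr p * 2 powr (- p * real k)" for k
      using \<delta> by (simp add: powr_divide powr_minus_divide powr_powr flip: powr_realpow) (simp add: mult.commute)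
    have summand: "(2 * \<delta> / 2 ^ k) powr p * sqrt (2 ^ (Suc k * n) / real m) = B * M powr (- \<delta> / 2) * r ^ k" for k
    proof -
      have "sqrt (2 ^ (Suc k * n) / real m) = 2 powr (real (Suc k) * \<delta> / 2) * M powr (- \<delta> / 2)"
      proof -
        have "sqrt (2 ^ (Suc k * n) / real m) = (2 powr (real (Suc k) * \<delta>) / real m) powr (1 / 2)"
          by (simp only: powr_realpow[symmetric] powr_half_sqrt \<delta>_def of_nat_mult) (simp add: powr_half_sqrt)
        also have "\<dots> = 2 powr (real (Suc k) * \<delta> / 2) * real m powr (- (1 / 2))"
          using m by (simp add: powr_divide powr_powr powr_minus_divide)
        finally show ?thesis by (simp only: mM)
      qed
      moreover have "2 powr (- p * real k) * 2 powr (real (Suc k) * \<delta> / 2) = 2 powr (\<delta> / 2) * r ^ k"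
      proof -
        have "r ^ k = 2 powr ((\<delta> / 2 - p) * real k)"
          by (simp add: r_def powr_powr flip: powr_realpow)
        then show ?thesis by (simp add: algebra_simps flip: powr_add) (simp add: add_divide_distrib)
      qed
      ultimately show ?thesis unfolding D B_def by simp
    qed
    have rK: "r ^ K \<le> M powr (\<delta> / 2 - p)"
    proof -
      have "r ^ K = (2 ^ K) powr (\<delta> / 2 - p)"
        by (simp add: r_def powr_powr mult.commute flip: powr_realpow)
      also have "\<dots> \<le> M powr (\<delta> / 2 - p)" using KM \<delta> by (intro powr_mono2) auto
      finally show ?thesis .
    qed
    have "(\<Sum>k<K. (2 * \<delta> / 2 ^ k) powr p * sqrt (2 ^ (Suc k * n) / real m))
        = B * M powr (- \<delta> / 2) * ((r ^ K - 1) / (r - 1))"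
      unfolding summand using r1 by (simp add: geometric_sum flip: sum_distrib_left)
    also have "\<dots> \<le> B * M powr (- \<delta> / 2) * (M powr (\<delta> / 2 - p) / (r - 1))"
      using rK r1 B0 by (intro mult_left_mono divide_right_mono) auto
    also have "\<dots> = B / (r - 1) * M powr (- p)"
      by (simp flip: powr_add)
    finally have s: "(\<Sum>k<K. (2 * \<delta> / 2 ^ k) powr p * sqrt (2 ^ (Suc k * n) / real m))
        \<le> B / (r - 1) * M powr (- p)" .
    have "2 * \<delta> / 2 ^ K \<le> 4 * \<delta> / M"
      using KM \<delta> M1 by (simp add: field_simps)
    then have "(2 * \<delta> / 2 ^ K) powr p \<le> (4 * \<delta> / M) powr p"
      using \<delta> p by (intro powr_mono2) auto
    also have "\<dots> = (4 * \<delta>) powr p * M powr (- p)"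
      using \<delta> M1 by (simp add: powr_divide powr_minus_divide)
    finally have "(2 * \<delta> / 2 ^ K) powr p
        + (\<Sum>k<K. (2 * \<delta> / 2 ^ k) powr p * sqrt (2 ^ (Suc k * n) / real m))
      \<le> ((4 * \<delta>) powr p + B / (r - 1)) * real m powr (- p / \<delta>)"
      using s unfolding mM distrib_right by linarith
    then show "\<exists>K. (2 * real n / 2 ^ K) powr p
        + (\<Sum>k<K. (2 * real n / 2 ^ k) powr p * sqrt (2 ^ (Suc k * n) / real m))
      \<le> ((4 * \<delta>) powr p + B / (r - 1)) * real m powr (- p / real n)"
      unfolding \<delta>_def by blast
  qed
qed

section \<open>Lower integrals, infima and roots of extended nonnegative reals\<close>

text \<open>The Wasserstein distance is not shown to depend measurably on the data, so this rests on the
  nonnegative integral being a lower integral: simple functions below \<open>k * f + c\<close> are pulled back to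
  simple functions below \<open>f\<close>.\<close>

lemma nn_integral_affine_le:
  fixes f :: "'a \<Rightarrow> ennreal"
  assumes "prob_space M" and k: "0 < k" "k < \<top>" and c: "c < \<top>"
  shows "(\<integral>\<^sup>+x. k * f x + c \<partial>M) \<le> k * (\<integral>\<^sup>+x. f x \<partial>M) + c"
proof -
  interpret prob_space M by fact
  have cn: "c \<noteq> \<top>" using c by simp
  show ?thesis
    unfolding nn_integral_def[of M "\<lambda>x. k * f x + c"]
  proof (rule SUP_least)
    fix g assume "g \<in> {g. simple_function M g \<and> g \<le> (\<lambda>x. k * f x + c)}"
    then have g: "simple_function M g" and le: "\<And>x. g x \<le> k * f x + c" by (auto simp: le_fun_def)
    have [measurable]: "g \<in> borel_measurable M" by (rule borel_measurable_simple_function[OF g])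
    \<comment> \<open>The inverse of the affine map. Subtraction is truncated at 0, so
      \<open>g x \<le> k * g' x + c\<close> also holds where \<open>g x\<close> is below
      \<open>c\<close>. Since \<open>g'\<close> is measurable, linearity of the integral applies to
      it.\<close>
    define g' where "g' x = (g x - c) / k" for x
    have g'_le: "g' x \<le> f x" for x
    proof -
      have "g x - c \<le> f x * k"
        using le[of x] cn by (simp add: ennreal_minus_le_iff ac_simps)
      then have "g' x \<le> f x * k / k" unfolding g'_def by (rule divide_right_mono_ennreal)
      also have "\<dots> = f x" using k by (simp add: ennreal_mult_divide_eq)
      finally show ?thesis .
    qed
    have g_le: "g x \<le> k * g' x + c" for x
    proof -
      have "k * g' x = g x - c"
        unfolding g'_def using k
        by (subst mult.commute, subst ennreal_divide_times) (simp add: ennreal_divide_self)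
      then show ?thesis using cn ennreal_minus_le_iff[of "g x" c "k * g' x"] by (simp add: add.commute)
    qed
    have "integral\<^sup>S M g = (\<integral>\<^sup>+x. g x \<partial>M)" using g by (simp add: nn_integral_eq_simple_integral)
    also have "\<dots> \<le> (\<integral>\<^sup>+x. k * g' x + c \<partial>M)" by (intro nn_integral_mono g_le)
    also have "\<dots> = k * (\<integral>\<^sup>+x. g' x \<partial>M) + c"
      unfolding g'_def by (simp add: nn_integral_add nn_integral_cmult emeasure_space_1)
    also have "\<dots> \<le> k * (\<integral>\<^sup>+x. f x \<partial>M) + c"
      by (intro add_mono mult_left_mono nn_integral_mono g'_le) auto
    finally show "integral\<^sup>S M g \<le> k * (\<integral>\<^sup>+x. f x \<partial>M) + c" .
  qed
qed

text \<open>A continuous increasing map commutes with the infimum of a nonempty set; for the empty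
  set both sides are infinite because \<open>a\<close> is positive. This carries a bound valid for
  every coupling over to the infimum of the costs.\<close>

lemma ennreal_Inf_affine:
  fixes S :: "ennreal set"
  assumes "a < \<top>" "0 < a"
  shows "(INF x\<in>S. a * (x + c)) = a * (Inf S + c)"
proof (cases "S = {}")
  case True
  then show ?thesis using assms by (simp add: ennreal_mult_eq_top_iff ennreal_mult_top)
next
  case False
  have "((\<lambda>x. a * (x + c)) \<longlongrightarrow> a * (Inf S + c)) (at_right (Inf S))"
    using assms by (intro ennreal_tendsto_cmult tendsto_add tendsto_const tendsto_ident_at) auto
  then have "a * (Inf S + c) = Inf ((\<lambda>x. a * (x + c)) ` S)"
    using False by (intro continuous_at_Inf_mono)
      (auto simp: mono_def continuous_within intro!: mult_left_mono add_right_mono)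
  then show ?thesis by simp
qed

lemma ennreal_powr_mono:
  assumes "0 \<le> a" "x \<le> y"
  shows "ennreal_powr x a \<le> ennreal_powr y a"
proof (cases "y = \<top>")
  case False
  then have "x \<noteq> \<top>" using assms(2) by (auto simp: top_unique)
  with False show ?thesis
    using assms unfolding ennreal_powr_def
    by (auto intro!: ennreal_leI powr_mono2 enn2real_mono simp: less_top)
qed (simp add: ennreal_powr_def)

text \<open>A bound that is affine in \<open>g\<close>; with \<open>t\<close> the target rate of the mean of \<open>g\<close>, it takes the place
  of Jensen's inequality for \<open>g powr (1 / p)\<close>.\<close>

lemma ennreal_powr_inverse_le:
  fixes g t p :: real
  assumes p: "1 \<le> p" and g: "0 \<le> g" and t: "0 < t"
  shows "ennreal_powr (ennreal (2 powr p) * (x + ennreal g)) (1 / p)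
    \<le> 4 * ennreal_powr x (1 / p) + ennreal (4 * t powr (1 / p) * (1 + g / t))"
proof (cases x)
  case top
  then show ?thesis by (simp add: ennreal_powr_def ennreal_mult_top)
next
  case (real y)
  \<comment> \<open>With \<open>u = g / t\<close> this is \<open>u powr (1 / p) \<le> 1 + u\<close>:
    up to 1 the left side is at most 1, and beyond 1 it is at most \<open>u\<close> because
    \<open>1 / p \<le> 1\<close>.\<close>
  have gt: "g powr (1 / p) \<le> t powr (1 / p) * (1 + g / t)"
  proof -
    have "(g / t) powr (1 / p) \<le> 1 + g / t"
    proof (cases "g / t \<le> 1")
      case True
      then have "(g / t) powr (1 / p) \<le> 1 powr (1 / p)"
        using g t p by (intro powr_mono2) auto
      moreover have "0 \<le> g / t" using g t by simp
      ultimately show ?thesis unfolding powr_one_eq_one by linarith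
    next
      case False
      then have "(g / t) powr (1 / p) \<le> (g / t) powr 1"
        using p by (intro powr_mono) auto
      with False show ?thesis by simp
    qed
    then have "t powr (1 / p) * (g / t) powr (1 / p) \<le> t powr (1 / p) * (1 + g / t)"
      by (intro mult_left_mono) auto
    then show ?thesis using g t by (simp add: powr_divide)
  qed
  \<comment> \<open>The 4 arises from two factors 2: one is \<open>(2 powr p) powr (1 / p)\<close>,
    the other bounds the \<open>2 powr (1 / p)\<close> that appears when \<open>y + g\<close> is
    replaced by twice the maximum.\<close>
  have "(2 powr p * (y + g)) powr (1 / p) = 2 * (y + g) powr (1 / p)"
    using p real g by (simp add: powr_mult powr_powr)
  also have "\<dots> \<le> 2 * (2 * max y g) powr (1 / p)"
    using p real g by (intro mult_left_mono powr_mono2) auto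
  also have "\<dots> = 2 * (2 powr (1 / p) * max y g powr (1 / p))"
    using real g by (simp add: powr_mult)
  also have "\<dots> \<le> 2 * (2 powr 1 * max y g powr (1 / p))"
    using p by (intro mult_left_mono mult_right_mono powr_mono) auto
  also have "\<dots> \<le> 4 * (y powr (1 / p) + g powr (1 / p))"
    by (auto simp: max_def)
  also have "\<dots> \<le> 4 * y powr (1 / p) + 4 * t powr (1 / p) * (1 + g / t)"
    using gt by simp
  finally have le: "(2 powr p * (y + g)) powr (1 / p) \<le> 4 * y powr (1 / p) + 4 * t powr (1 / p) * (1 + g / t)" .
  have "ennreal (2 powr p) * (x + ennreal g) = ennreal (2 powr p * (y + g))"
    using real g by (simp add: ennreal_mult)
  then have "ennreal_powr (ennreal (2 powr p) * (x + ennreal g)) (1 / p)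
      = ennreal ((2 powr p * (y + g)) powr (1 / p))"
    using real g by (simp add: ennreal_powr_def)
  also have "\<dots> \<le> ennreal (4 * y powr (1 / p) + 4 * t powr (1 / p) * (1 + g / t))"
    by (rule ennreal_leI[OF le])
  also have "\<dots> = 4 * ennreal_powr x (1 / p) + ennreal (4 * t powr (1 / p) * (1 + g / t))"
    using real g t by (simp add: ennreal_powr_def ennreal_mult ennreal_plus)
  finally show ?thesis .
qed

section \<open>From cell discrepancies to the mean distance after resampling\<close>

lemma measurable_ident_cube: "(\<lambda>x. x) \<in> (cube :: (real ^ 'd) measure) \<rightarrow>\<^sub>M borel"
  unfolding cube_def by (rule measurable_restrict_space1) simp

text \<open>The randomness of the sample is isolated in \<open>G\<close>, which adds up the level
  costs weighted by the cell discrepancies. It is measurable, so its mean can be computed term by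
  term, and one \<open>G\<close> serves all \<open>\<mu>\<close> at once.\<close>

lemma empirical_transport:
  fixes p :: real
  assumes p: "1 \<le> p" and d: "real CARD('d) > 2 * p"
  obtains C where "C > 0"
    "\<And>(\<nu> :: (real ^ 'd) measure) m. \<nu> \<in> space (prob_algebra cube) \<Longrightarrow> m \<ge> 1 \<Longrightarrow>
      \<exists>G. G \<in> borel_measurable (iid_sample m \<nu>) \<and> (\<forall>z. 0 \<le> G z) \<and>
        (\<integral>\<^sup>+z. ennreal (G z) \<partial>iid_sample m \<nu>) \<le> ennreal (C * real m powr (- p / real CARD('d))) \<and>
        (\<forall>z\<in>space (iid_sample m \<nu>). \<forall>\<mu>\<in>space (prob_algebra cube).
          (INF \<pi>\<in>couplings \<mu> (empirical cube m z). \<integral>\<^sup>+(x, y). ennreal (norm (x - y) powr p) \<partial>\<pi>)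
          \<le> ennreal (2 powr p) * ((INF \<pi>\<in>couplings \<nu> \<mu>. \<integral>\<^sup>+(x, y). ennreal (norm (x - y) powr p) \<partial>\<pi>)
              + ennreal (G z)))"
proof -
  let ?n = "CARD('d)"
  obtain C where C: "C > 0" and bound: "\<And>m. m \<ge> 1 \<Longrightarrow> \<exists>K. (2 * real ?n / 2 ^ K) powr p
        + (\<Sum>k<K. (2 * real ?n / 2 ^ k) powr p * sqrt (2 ^ (Suc k * ?n) / real m))
      \<le> C * real m powr (- p / real ?n)"
    using dyadic_sum_bound[OF p d] by blast
  show ?thesis
  proof (rule that[OF C])
    fix \<nu> :: "(real ^ 'd) measure" and m :: nat
    assume \<nu>: "\<nu> \<in> space (prob_algebra cube)" and m: "m \<ge> 1"
    interpret \<nu>: prob_space \<nu> using \<nu> by (simp add: space_prob_algebra)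
    have s\<nu>: "sets \<nu> = sets cube" using \<nu> by (simp add: space_prob_algebra)
    note sp\<nu> = sets_eq_imp_space_eq[OF s\<nu>]
    obtain K where K: "(2 * real ?n / 2 ^ K) powr p
        + (\<Sum>k<K. (2 * real ?n / 2 ^ k) powr p * sqrt (2 ^ (Suc k * ?n) / real m))
      \<le> C * real m powr (- p / real ?n)"
      using bound[OF m] by blast
    define D where "D k = (2 * real ?n / 2 ^ k) powr p" for k
    define cell where "cell k Q = dyadic_label k -` {Q} \<inter> space (cube :: (real ^ 'd) measure)" for k Q
    define S where "S k z = (\<Sum>Q\<in>dyadic_labels k. \<bar>measure \<nu> (cell k Q)
        - (\<Sum>j<m. indicator (cell k Q) (z j)) / real m\<bar>)" for k and z :: "nat \<Rightarrow> real ^ 'd"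
    define G where "G z = D K + (\<Sum>k<K. D k * S (Suc k) z)" for z
    have D0: "0 \<le> D k" for k by (simp add: D_def)
    have S0: "0 \<le> S k z" for k z by (simp add: S_def sum_nonneg)
    have cell: "cell k Q \<in> sets cube" if "Q \<in> dyadic_labels k" for k Q
      unfolding cell_def by (intro measurable_sets[OF measurable_dyadic_label]) (use that in auto)
    have Sm[measurable]: "S k \<in> borel_measurable (iid_sample m \<nu>)" for k
    proof -
      have "(\<lambda>z. indicator (cell k Q) (z j) :: real) \<in> borel_measurable (iid_sample m \<nu>)"
        if "Q \<in> dyadic_labels k" "j < m" for Q j
        unfolding iid_sample_def
        by (rule measurable_compose[OF measurable_component_singleton])
           (use that cell in \<open>auto simp: s\<nu> intro!: borel_measurable_indicator\<close>)
      then show ?thesis unfolding S_def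
        by (intro borel_measurable_sum borel_measurable_abs borel_measurable_diff
            borel_measurable_divide borel_measurable_const) auto
    qed
    have ES: "(\<integral>\<^sup>+z. ennreal (S k z) \<partial>iid_sample m \<nu>) \<le> ennreal (sqrt (2 ^ (k * ?n) / real m))" for k
    proof -
      have "(\<integral>\<^sup>+z. ennreal (S k z) \<partial>iid_sample m \<nu>)
          \<le> ennreal (sqrt (real (card (dyadic_labels k :: ('d \<Rightarrow> int) set)) / real m))"
        unfolding S_def using m cell
        by (intro \<nu>.expected_cell_discrepancy finite_dyadic_labels)
           (auto simp: s\<nu> disjoint_family_on_def cell_def)
      also have "\<dots> \<le> ennreal (sqrt (2 ^ (k * ?n) / real m))"
        using of_nat_mono[OF card_dyadic_labels[where 'd = 'd, of k], where 'a = real]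
        by (intro ennreal_leI real_sqrt_le_mono divide_right_mono) auto
      finally show ?thesis .
    qed
    interpret I: prob_space "iid_sample m \<nu>"
      unfolding iid_sample_def by (intro prob_space_PiM \<nu>.prob_space_axioms)
    show "\<exists>G. G \<in> borel_measurable (iid_sample m \<nu>) \<and> (\<forall>z. 0 \<le> G z) \<and>
        (\<integral>\<^sup>+z. ennreal (G z) \<partial>iid_sample m \<nu>) \<le> ennreal (C * real m powr (- p / real CARD('d))) \<and>
        (\<forall>z\<in>space (iid_sample m \<nu>). \<forall>\<mu>\<in>space (prob_algebra cube).
          (INF \<pi>\<in>couplings \<mu> (empirical cube m z). \<integral>\<^sup>+(x, y). ennreal (norm (x - y) powr p) \<partial>\<pi>)
          \<le> ennreal (2 powr p) * ((INF \<pi>\<in>couplings \<nu> \<mu>. \<integral>\<^sup>+(x, y). ennreal (norm (x - y) powr p) \<partial>\<pi>)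
              + ennreal (G z)))"
    proof (intro exI[of _ G] conjI ballI allI)
      show "G \<in> borel_measurable (iid_sample m \<nu>)" unfolding G_def by measurable
      show "0 \<le> G z" for z unfolding G_def using D0 S0 by (intro add_nonneg_nonneg sum_nonneg) auto
      have "(\<integral>\<^sup>+z. ennreal (G z) \<partial>iid_sample m \<nu>)
          = (\<integral>\<^sup>+z. ennreal (D K) + (\<Sum>k<K. ennreal (D k) * ennreal (S (Suc k) z)) \<partial>iid_sample m \<nu>)"
        unfolding G_def using D0 S0
        by (intro nn_integral_cong) (simp add: ennreal_plus sum_nonneg sum_ennreal ennreal_mult[symmetric])
      also have "\<dots> = ennreal (D K) + (\<Sum>k<K. ennreal (D k) * (\<integral>\<^sup>+z. ennreal (S (Suc k) z) \<partial>iid_sample m \<nu>))"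
        by (simp add: nn_integral_add nn_integral_sum nn_integral_cmult I.emeasure_space_1)
      also have "\<dots> \<le> ennreal (D K) + (\<Sum>k<K. ennreal (D k) * ennreal (sqrt (2 ^ (Suc k * ?n) / real m)))"
        by (intro add_left_mono sum_mono mult_left_mono ES) auto
      also have "\<dots> = ennreal (D K + (\<Sum>k<K. D k * sqrt (2 ^ (Suc k * ?n) / real m)))"
        using D0 by (simp add: ennreal_plus sum_nonneg sum_ennreal ennreal_mult[symmetric] del: mult_Suc power_add)
      also have "\<dots> \<le> ennreal (C * real m powr (- p / real CARD('d)))"
        using K by (intro ennreal_leI) (simp add: D_def del: mult_Suc)
      finally show "(\<integral>\<^sup>+z. ennreal (G z) \<partial>iid_sample m \<nu>)
        \<le> ennreal (C * real m powr (- p / real CARD('d)))" .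
    next
      fix z and \<mu> :: "(real ^ 'd) measure"
      assume z: "z \<in> space (iid_sample m \<nu>)" and \<mu>: "\<mu> \<in> space (prob_algebra cube)"
      let ?e = "empirical cube m z"
      have zi: "z i \<in> space cube" if "i < m" for i
        using z that by (auto simp: iid_sample_def space_PiM PiE_iff sp\<nu>)
      have e: "?e \<in> space (prob_algebra cube)"
        using m zi by (intro empirical_in_prob_algebra) auto
      have cost: "norm (x - y) powr p \<le> D k" if "dyadic_label k x = dyadic_label k y" for k and x y :: "real ^ 'd"
        unfolding D_def using dyadic_label_dist[OF that] p by (intro powr_mono2) auto
      \<comment> \<open>The plan is chosen separately for each sample \<open>z\<close>; only the
        bound \<open>G z\<close> on its cost enters the later integral.\<close>
      obtain w where w: "(\<lambda>(x, y). w x y) \<in> borel_measurable (cube \<Otimes>\<^sub>M cube)"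
        "AE x in \<nu>. (\<integral>\<^sup>+y. w x y \<partial>?e) = 1" "AE y in ?e. (\<integral>\<^sup>+x. w x y \<partial>\<nu>) = 1"
        and wc: "(\<integral>\<^sup>+x. \<integral>\<^sup>+y. w x y * ennreal (norm (x - y) powr p) \<partial>?e \<partial>\<nu>) \<le> ennreal (D K + (\<Sum>k<K. D k *
       (\<Sum>Q\<in>dyadic_labels (Suc k). \<bar>measure \<nu> (dyadic_label (Suc k) -` {Q} \<inter> space cube)
                         - measure ?e (dyadic_label (Suc k) -` {Q} \<inter> space cube)\<bar>)))"
        by (rule nested_partition_density[of \<nu> cube ?e dyadic_labels dyadic_label D
              "\<lambda>x y. norm (x - y) powr p" K, OF \<nu> e finite_dyadic_labels measurable_dyadic_label
              dyadic_label_root dyadic_label_nested D0 cost]) (assumption | rule that)+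
      have me: "measure ?e (cell k Q) = (\<Sum>j<m. indicator (cell k Q) (z j)) / real m"
        if "Q \<in> dyadic_labels k" for k Q
        using m zi cell[OF that] by (intro measure_empirical) auto
      have "D K + (\<Sum>k<K. D k *
       (\<Sum>Q\<in>dyadic_labels (Suc k). \<bar>measure \<nu> (dyadic_label (Suc k) -` {Q} \<inter> space cube)
                         - measure ?e (dyadic_label (Suc k) -` {Q} \<inter> space cube)\<bar>)) = G z"
        unfolding G_def S_def cell_def[symmetric] by (simp add: me cong: sum.cong)
      note wc = wc[unfolded this]
      \<comment> \<open>The bound holds for each coupling of \<open>\<nu>\<close> and
        \<open>\<mu>\<close>, and the infimum is taken afterwards. Indexing by costs instead of
        couplings matches the form of \<open>ennreal_Inf_affine\<close>.\<close>
      have "(INF \<pi>\<in>couplings \<mu> ?e. \<integral>\<^sup>+(x, y). ennreal (norm (x - y) powr p) \<partial>\<pi>)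
          \<le> (INF c\<in>(\<lambda>\<pi>. \<integral>\<^sup>+(x, y). ennreal (norm (x - y) powr p) \<partial>\<pi>) ` couplings \<nu> \<mu>.
              ennreal (2 powr p) * (c + ennreal (G z)))"
      proof (rule INF_greatest, erule imageE)
        fix c \<pi> assume "\<pi> \<in> couplings \<nu> \<mu>"
          and c: "c = (\<integral>\<^sup>+(x, y). ennreal (norm (x - y) powr p) \<partial>\<pi>)"
        have "(INF \<pi>\<in>couplings \<mu> ?e. \<integral>\<^sup>+(x, y). ennreal (norm (x - y) powr p) \<partial>\<pi>)
            \<le> ennreal (2 powr p) * (c + (\<integral>\<^sup>+x. \<integral>\<^sup>+y. w x y * ennreal (norm (x - y) powr p) \<partial>?e \<partial>\<nu>))"
          unfolding c using p \<open>\<pi> \<in> couplings \<nu> \<mu>\<close>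
          by (intro coupling_cost_triangle[OF \<mu> \<nu> e measurable_ident_cube w]) auto
        also have "\<dots> \<le> ennreal (2 powr p) * (c + ennreal (G z))"
          by (intro mult_left_mono add_left_mono wc) auto
        finally show "(INF \<pi>\<in>couplings \<mu> ?e. \<integral>\<^sup>+(x, y). ennreal (norm (x - y) powr p) \<partial>\<pi>)
            \<le> ennreal (2 powr p) * (c + ennreal (G z))" .
      qed
      also have "\<dots> = ennreal (2 powr p) * ((INF \<pi>\<in>couplings \<nu> \<mu>. \<integral>\<^sup>+(x, y). ennreal (norm (x - y) powr p) \<partial>\<pi>)
              + ennreal (G z))"
        by (rule ennreal_Inf_affine) auto
      finally show "(INF \<pi>\<in>couplings \<mu> ?e. \<integral>\<^sup>+(x, y). ennreal (norm (x - y) powr p) \<partial>\<pi>)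
          \<le> ennreal (2 powr p) * ((INF \<pi>\<in>couplings \<nu> \<mu>. \<integral>\<^sup>+(x, y). ennreal (norm (x - y) powr p) \<partial>\<pi>)
              + ennreal (G z))" .
    qed
  qed
qed

text \<open>This is the estimate for fixed data, with the value of the estimator to be inserted for
  \<open>\<nu>\<close>. The root in \<open>wasserstein\<close> is handled by
  \<open>ennreal_powr_inverse_le\<close>, whose right side is affine in \<open>G z\<close> and can
  be integrated directly.\<close>

lemma resample_step:
  fixes p :: real
  assumes p: "1 \<le> p" and d: "real CARD('d) > 2 * p"
  obtains C where "C > 0"
    "\<And>(\<nu> :: (real ^ 'd) measure) \<mu> m. \<nu> \<in> space (prob_algebra cube) \<Longrightarrow>
      \<mu> \<in> space (prob_algebra cube) \<Longrightarrow> m \<ge> 1 \<Longrightarrow>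
      (\<integral>\<^sup>+z. wasserstein p \<mu> (empirical cube m z) \<partial>iid_sample m \<nu>)
        \<le> 4 * wasserstein p \<nu> \<mu> + ennreal (C * real m powr (- 1 / real CARD('d)))"
proof -
  let ?n = "real CARD('d)"
  obtain C where C: "C > 0" and emp:
    "\<And>(\<nu> :: (real ^ 'd) measure) m. \<nu> \<in> space (prob_algebra cube) \<Longrightarrow> m \<ge> 1 \<Longrightarrow>
      \<exists>G. G \<in> borel_measurable (iid_sample m \<nu>) \<and> (\<forall>z. 0 \<le> G z) \<and>
        (\<integral>\<^sup>+z. ennreal (G z) \<partial>iid_sample m \<nu>) \<le> ennreal (C * real m powr (- p / real CARD('d))) \<and>
        (\<forall>z\<in>space (iid_sample m \<nu>). \<forall>\<mu>\<in>space (prob_algebra cube).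
          (INF \<pi>\<in>couplings \<mu> (empirical cube m z). \<integral>\<^sup>+(x, y). ennreal (norm (x - y) powr p) \<partial>\<pi>)
          \<le> ennreal (2 powr p) * ((INF \<pi>\<in>couplings \<nu> \<mu>. \<integral>\<^sup>+(x, y). ennreal (norm (x - y) powr p) \<partial>\<pi>)
              + ennreal (G z)))"
    using empirical_transport[OF p d] by blast
  show ?thesis
  proof (rule that[of "4 * (1 + C)"])
    show "0 < 4 * (1 + C)" using C by simp
    fix \<nu> \<mu> :: "(real ^ 'd) measure" and m :: nat
    assume \<nu>: "\<nu> \<in> space (prob_algebra cube)" and \<mu>: "\<mu> \<in> space (prob_algebra cube)" and m: "m \<ge> 1"
    obtain G where [measurable]: "G \<in> borel_measurable (iid_sample m \<nu>)" and G0: "\<And>z. 0 \<le> G z"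
      and EG: "(\<integral>\<^sup>+z. ennreal (G z) \<partial>iid_sample m \<nu>) \<le> ennreal (C * real m powr (- p / ?n))"
      and cost: "\<And>z. z\<in>space (iid_sample m \<nu>) \<Longrightarrow>
          (INF \<pi>\<in>couplings \<mu> (empirical cube m z). \<integral>\<^sup>+(x, y). ennreal (norm (x - y) powr p) \<partial>\<pi>)
          \<le> ennreal (2 powr p) * ((INF \<pi>\<in>couplings \<nu> \<mu>. \<integral>\<^sup>+(x, y). ennreal (norm (x - y) powr p) \<partial>\<pi>)
              + ennreal (G z))"
      using emp[OF \<nu> m] \<mu> by blast
    have "prob_space \<nu>" using \<nu> by (simp add: space_prob_algebra)
    then interpret I: prob_space "iid_sample m \<nu>"
      unfolding iid_sample_def by (intro prob_space_PiM)
    \<comment> \<open>The order of the mean of \<open>G\<close>, which is at most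
      \<open>C * t\<close>. Hence \<open>4 * t powr (1 / p) * (1 + G z / t)\<close> has mean at most
      \<open>4 * (1 + C) * t powr (1 / p)\<close>.\<close>
    define t where "t = real m powr (- p / ?n)"
    have t0: "0 < t" using m by (simp add: t_def)
    have tp: "t powr (1 / p) = real m powr (- 1 / ?n)" using p by (simp add: t_def powr_powr)
    define A where "A = 4 * t powr (1 / p)"
    have A0: "0 \<le> A" by (simp add: A_def)
    have "(\<integral>\<^sup>+z. wasserstein p \<mu> (empirical cube m z) \<partial>iid_sample m \<nu>)
        \<le> (\<integral>\<^sup>+z. 4 * wasserstein p \<nu> \<mu> + ennreal (A * (1 + G z / t)) \<partial>iid_sample m \<nu>)"
    proof (rule nn_integral_mono)
      fix z assume z: "z \<in> space (iid_sample m \<nu>)"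
      have "wasserstein p \<mu> (empirical cube m z) \<le> ennreal_powr (ennreal (2 powr p) *
          ((INF \<pi>\<in>couplings \<nu> \<mu>. \<integral>\<^sup>+(x, y). ennreal (norm (x - y) powr p) \<partial>\<pi>) + ennreal (G z))) (1 / p)"
        unfolding wasserstein_def by (rule ennreal_powr_mono[OF _ cost[OF z]]) (use p in simp)
      also have "\<dots> \<le> 4 * wasserstein p \<nu> \<mu> + ennreal (A * (1 + G z / t))"
        unfolding wasserstein_def A_def by (rule ennreal_powr_inverse_le[OF p G0 t0])
      finally show "wasserstein p \<mu> (empirical cube m z)
          \<le> 4 * wasserstein p \<nu> \<mu> + ennreal (A * (1 + G z / t))" .
    qed
    also have "\<dots> = (\<integral>\<^sup>+z. 4 * wasserstein p \<nu> \<mu> + (ennreal A + ennreal (A / t) * ennreal (G z)) \<partial>iid_sample m \<nu>)"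
      using A0 t0 G0
      by (intro nn_integral_cong arg_cong2[where f = "(+)"] refl)
         (simp add: ennreal_mult[symmetric] ennreal_plus[symmetric] distrib_left del: ennreal_plus)
    also have "\<dots> = 4 * wasserstein p \<nu> \<mu> + (ennreal A + ennreal (A / t) * (\<integral>\<^sup>+z. ennreal (G z) \<partial>iid_sample m \<nu>))"
      by (simp add: nn_integral_add nn_integral_cmult I.emeasure_space_1)
    also have "\<dots> \<le> 4 * wasserstein p \<nu> \<mu> + (ennreal A + ennreal (A / t) * ennreal (C * t))"
      using EG unfolding t_def[symmetric] by (intro add_left_mono mult_left_mono) auto
    also have "ennreal A + ennreal (A / t) * ennreal (C * t) = ennreal (4 * (1 + C) * real m powr (- 1 / ?n))"
      unfolding tp[symmetric] using A0 t0 C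
      by (simp add: ennreal_mult[symmetric] ennreal_plus[symmetric] A_def algebra_simps del: ennreal_plus)
    finally show "(\<integral>\<^sup>+z. wasserstein p \<mu> (empirical cube m z) \<partial>iid_sample m \<nu>)
        \<le> 4 * wasserstein p \<nu> \<mu> + ennreal (4 * (1 + C) * real m powr (- 1 / ?n))" .
  qed
qed

section \<open>Averaging over the data\<close>

theorem corollary1:
  fixes p \<gamma> \<gamma>' :: real
    and \<P> :: "(real ^ 'd) measure set"
    and est :: "nat \<Rightarrow> (nat \<Rightarrow> real ^ 'd) \<Rightarrow> (real ^ 'd) measure"
  assumes "1 \<le> p" and "real CARD('d) > 2 * p"
    and "\<P> \<subseteq> space (prob_algebra cube)"
    and "estimator est"
    and "\<exists>C>0. \<forall>\<mu>\<in>\<P>. \<forall>n\<ge>1.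
           estimator_risk p est n \<mu> \<le> ennreal (C * real n powr (- \<gamma>' / real CARD('d)))"
    and "1 \<le> \<gamma>" and "\<gamma> \<le> \<gamma>'"
  shows "\<exists>C>0. \<forall>\<mu>\<in>\<P>. \<forall>n\<ge>1.
           resample_risk p est n (nat \<lceil>real n powr \<gamma>\<rceil>) \<mu>
             \<le> ennreal (C * real n powr (- \<gamma> / real CARD('d)))"
proof -
  let ?d = "real CARD('d)"
  obtain C where C: "C > 0" and step:
    "\<And>(\<nu> :: (real ^ 'd) measure) \<mu> m. \<nu> \<in> space (prob_algebra cube) \<Longrightarrow>
      \<mu> \<in> space (prob_algebra cube) \<Longrightarrow> m \<ge> 1 \<Longrightarrow>
      (\<integral>\<^sup>+z. wasserstein p \<mu> (empirical cube m z) \<partial>iid_sample m \<nu>)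
        \<le> 4 * wasserstein p \<nu> \<mu> + ennreal (C * real m powr (- 1 / ?d))"
    using resample_step[OF assms(1,2)] by blast
  obtain C' where C': "C' > 0" and risk: "\<And>\<mu> n. \<mu> \<in> \<P> \<Longrightarrow> n \<ge> 1 \<Longrightarrow>
      estimator_risk p est n \<mu> \<le> ennreal (C' * real n powr (- \<gamma>' / ?d))"
    using assms(5) by blast
  have d0: "0 < ?d" by simp
  show ?thesis
  \<comment> \<open>\<open>4 * C'\<close> pays for the error of the estimator, \<open>C\<close> for
    sampling from it.\<close>
  proof (intro exI[of _ "4 * C' + C"] conjI ballI allI impI)
    show "0 < 4 * C' + C" using C C' by simp
    fix \<mu> n assume \<mu>P: "\<mu> \<in> \<P>" and n: "1 \<le> (n::nat)"
    have \<mu>: "\<mu> \<in> space (prob_algebra cube)" using \<mu>P assms(3) by blast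
    then have "prob_space \<mu>" and s\<mu>: "sets \<mu> = sets cube" by (simp_all add: space_prob_algebra)
    then have I: "prob_space (iid_sample n \<mu>)"
      unfolding iid_sample_def by (intro prob_space_PiM)
    \<comment> \<open>Samples from \<open>\<mu>\<close> and from \<open>cube\<close> range over the
      same space, so the values of the estimator are probability measures on the cube at every data
      point.\<close>
    have est: "est n x \<in> space (prob_algebra cube)" if "x \<in> space (iid_sample n \<mu>)" for x
    proof -
      have "x \<in> space (PiM {..<n} (\<lambda>_. cube))"
        using that sets_eq_imp_space_eq[OF s\<mu>] by (simp add: iid_sample_def space_PiM)
      with assms(4) show ?thesis unfolding estimator_def by (blast dest: measurable_space)
    qed
    define m where "m = nat \<lceil>real n powr \<gamma>\<rceil>"
    have mn: "real n powr \<gamma> \<le> real m" unfolding m_def by (rule real_nat_ceiling_ge)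
    have n1: "1 \<le> real n powr \<gamma>" using n assms(6) by (simp add: ge_one_powr_ge_zero)
    have m: "1 \<le> m" using mn n1 by linarith
    \<comment> \<open>The sampling error decreases in \<open>m\<close>, so rounding
      \<open>n powr \<gamma>\<close> up preserves the bound.\<close>
    have rate: "real m powr (- 1 / ?d) \<le> real n powr (- \<gamma> / ?d)"
    proof -
      have "real m powr (- 1 / ?d) \<le> (real n powr \<gamma>) powr (- 1 / ?d)"
        using mn n n1 d0 by (intro powr_mono2') auto
      then show ?thesis by (simp add: powr_powr)
    qed
    have rate': "real n powr (- \<gamma>' / ?d) \<le> real n powr (- \<gamma> / ?d)"
      using n assms(7) d0 by (intro powr_mono divide_right_mono) auto
    have "resample_risk p est n m \<mu>
        \<le> (\<integral>\<^sup>+x. 4 * wasserstein p (est n x) \<mu> + ennreal (C * real m powr (- 1 / ?d)) \<partial>iid_sample n \<mu>)"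
      unfolding resample_risk_def by (intro nn_integral_mono step est \<mu> m)
    \<comment> \<open>An inequality takes the place of linearity, as the distance is not shown to be
      measurable in the data.\<close>
    also have "\<dots> \<le> 4 * estimator_risk p est n \<mu> + ennreal (C * real m powr (- 1 / ?d))"
      unfolding estimator_risk_def by (rule nn_integral_affine_le[OF I]) auto
    also have "\<dots> \<le> 4 * ennreal (C' * real n powr (- \<gamma> / ?d)) + ennreal (C * real n powr (- \<gamma> / ?d))"
    proof (intro add_mono mult_left_mono ennreal_leI)
      show "estimator_risk p est n \<mu> \<le> ennreal (C' * real n powr (- \<gamma> / ?d))"
        using C' rate' by (intro order_trans[OF risk[OF \<mu>P n]] ennreal_leI mult_left_mono) auto
    qed (use C rate in auto)
    also have "\<dots> = ennreal (4 * (C' * real n powr (- \<gamma> / ?d)) + C * real n powr (- \<gamma> / ?d))"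
      using C C' by (simp add: ennreal_mult ennreal_plus)
    also have "4 * (C' * real n powr (- \<gamma> / ?d)) + C * real n powr (- \<gamma> / ?d)
        = (4 * C' + C) * real n powr (- \<gamma> / ?d)" by (simp add: distrib_right)
    finally show "resample_risk p est n (nat \<lceil>real n powr \<gamma>\<rceil>) \<mu>
        \<le> ennreal ((4 * C' + C) * real n powr (- \<gamma> / ?d))"
      unfolding m_def .
  qed
qed

end
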